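(* Let $m \geq 0$, $\ell>0$ and $0 < T \leq \dfrac{\sqrt{\pi}\, e^{3/2}}{2 \cdot 3^{5/4}}\, \ell^2$. Let $g \in H^m(0,T)$ be such that $g^{(n)}(0) = 0$ for all integers $n$ with $0\leq n < m-\frac 12$. Then there exist functions $a, b \in H^m(0, T)$ such that the solution $q(x, t)$ to the heat equation finite interval problem $$ \begin{aligned} &q_t - q_{xx} = 0, \quad x \in (0, \ell), \ t \in (0, T),\\ &q(x, 0) = 0, \quad x \in (0, \ell),\\ &q(0, t) = g(t), \quad q(\ell, t) = 0, \quad t \in (0, T), \end{aligned} $$ can be expressed as the sum $$ q(x, t) = v(x, t) \big|_{x \in (0, \ell)} + w(x, t) \big|_{x \in (0, \ell)} $$ of the restrictions to $(0, \ell)$ of the solutions $v$, $w$ to the heat equation half-line problems $$ \begin{aligned} &v_t - v_{xx} = 0, \quad x \in (0, \infty), \ t \in (0, T),\\ &v(x, 0) = 0, \quad x \in (0, \infty),\\ &v(0, t) = a(t), \quad t \in (0, T), \end{aligned} \qquad \begin{aligned} &w_t - w_{xx} = 0, \quad x \in (-\infty, \ell), \ t \in (0, T),\\ &w(x, 0) = 0, \quad x \in (-\infty, \ell),\\ &w(\ell, t) = b(t), \quad t \in (0, T). \end{aligned} $$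
   Context: $H^m(0,T)$ is the usual $L^2$-based Sobolev space on $(0,T)$ (fractional when $m\notin\mathbb N_0$), with $H^0=L^2$. The solutions of the three linear problems are those given by the unified transform (Fokas method) formulae. Let $\mathcal D = \{k\in\mathbb C: \frac{\pi}{4}<\arg k<\frac{3\pi}{4}\}$ and let $\partial\mathcal D$ be its positively oriented boundary (coming in from infinity along the ray $\arg k = \frac{3\pi}{4}$ to $0$, then going out to infinity along the ray $\arg k=\frac{\pi}{4}$). For a function $f$ on $(0,T)$ put $\widetilde f(k^2,t)=\int_0^t e^{k^2 z} f(z)\,dz$. Then $$ v(x,t)=\frac{1}{i\pi}\int_{\partial\mathcal D} e^{ikx-k^2t}\,k\,\widetilde a(k^2,t)\,dk,\quad x>0, \qquad w(x,t)=\frac{1}{i\pi}\int_{\partial\mathcal D} e^{ik(\ell-x)-k^2t}\,k\,\widetilde b(k^2,t)\,dk,\quad x<\ell, $$ $$ q(x,t)=\frac{1}{i\pi}\int_{\partial\mathcal D}\frac{\sin[k(\ell-x)]}{\sin(k\ell)}\,e^{-k^2t}\,k\,\widetilde g(k^2,t)\,dk,\quad x\in(0,\ell). $$ The boundary data $a,b$ realizing the decomposition are those that satisfy the matching conditions $a(t)=g(t)-w(0,t)$ and $b(t)=-v(\ell,t)$ for $t \in (0,T)$ (almost everywhere, for rough data). *)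

theory Defs
  imports "HOL-Analysis.Analysis"
begin

section \<open>The Sobolev spaces of real order on a bounded interval\<close>

text \<open>Functions on the interval from 0 to \<open>T\<close> are represented by total functions on the reals whose
  values outside the open interval are never used; functions are not identified when they agree
  almost everywhere.\<close>

definition L2_space :: "real \<Rightarrow> (real \<Rightarrow> complex) set" where
  "L2_space T = {f. f \<in> borel_measurable (lebesgue_on {0<..<T}) \<and>
     integrable (lebesgue_on {0<..<T}) (\<lambda>t. (norm (f t))\<^sup>2)}"

definition test_function :: "real \<Rightarrow> (real \<Rightarrow> real) \<Rightarrow> bool" where
  "test_function T \<phi> \<longleftrightarrow>
     (\<forall>n x. (deriv ^^ n) \<phi> field_differentiable at x) \<and>
     (\<exists>K. compact K \<and> K \<subseteq> {0<..<T} \<and> (\<forall>x. x \<notin> K \<longrightarrow> \<phi> x = 0))"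

text \<open>\<open>h\<close> is an \<open>n\<close>-th weak derivative of \<open>f\<close>. This is only used for \<open>f\<close> and \<open>h\<close> that are integrable
  on the interval. For \<open>n = 0\<close> it says that \<open>f\<close> and \<open>h\<close> agree almost everywhere.\<close>

definition weak_derivative ::
  "real \<Rightarrow> nat \<Rightarrow> (real \<Rightarrow> complex) \<Rightarrow> (real \<Rightarrow> complex) \<Rightarrow> bool" where
  "weak_derivative T n f h \<longleftrightarrow>
     (\<forall>\<phi>. test_function T \<phi> \<longrightarrow>
        (LINT t|lebesgue_on {0<..<T}. complex_of_real ((deriv ^^ n) \<phi> t) * f t) =
        (- 1) ^ n * (LINT t|lebesgue_on {0<..<T}. complex_of_real (\<phi> t) * h t))"

text \<open>The square of the Gagliardo (Sobolev--Slobodeckij) seminorm of order \<open>\<sigma>\<close>, \<open>0 < \<sigma> < 1\<close>.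
  The integrand is 0 on the diagonal, by the convention for division by 0.\<close>

definition gagliardo :: "real \<Rightarrow> real \<Rightarrow> (real \<Rightarrow> complex) \<Rightarrow> ennreal" where
  "gagliardo T \<sigma> h =
     (\<integral>\<^sup>+ s. (\<integral>\<^sup>+ t. ennreal ((norm (h s - h t))\<^sup>2 / \<bar>s - t\<bar> powr (1 + 2 * \<sigma>))
        \<partial>lebesgue_on {0<..<T}) \<partial>lebesgue_on {0<..<T})"

text \<open>For \<open>m \<ge> 0\<close>: all weak derivatives up to order \<open>\<lfloor>m\<rfloor>\<close> are square integrable and, if \<open>m\<close> is not an
  integer, the top one has finite seminorm of order \<open>m - \<lfloor>m\<rfloor>\<close>.\<close>

definition sobolev :: "real \<Rightarrow> real \<Rightarrow> (real \<Rightarrow> complex) set" where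
  "sobolev m T = {f \<in> L2_space T.
     (\<forall>n \<le> nat \<lfloor>m\<rfloor>. \<exists>h \<in> L2_space T. weak_derivative T n f h) \<and>
     (m \<notin> \<int> \<longrightarrow>
        (\<exists>h \<in> L2_space T. weak_derivative T (nat \<lfloor>m\<rfloor>) f h \<and> gagliardo T (m - of_int \<lfloor>m\<rfloor>) h < \<infinity>))}"

text \<open>For \<open>f\<close> in \<open>sobolev m T\<close> and \<open>n < m - 1/2\<close> the \<open>n\<close>-th derivative has a representative that is
  continuous up to the end point; its value at 0 is the trace.\<close>

definition zero_trace :: "real \<Rightarrow> nat \<Rightarrow> (real \<Rightarrow> complex) \<Rightarrow> bool" where
  "zero_trace T n f \<longleftrightarrow>
     (\<exists>h. continuous_on {0..T} h \<and> weak_derivative T n f h \<and> h 0 = 0)"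

section \<open>The unified transform solutions\<close>

text \<open>The integral along the boundary of the sector \<open>\<pi>/4 < arg k < 3\<pi>/4\<close>, in along the ray
  \<open>arg k = 3\<pi>/4\<close> and out along the ray \<open>arg k = \<pi>/4\<close>. In the formulas below both integrals
  converge absolutely if the boundary datum is integrable, since \<open>k\<^sup>2\<close> is purely imaginary on the rays and
  the spatial factors decay exponentially.\<close>

definition sector_boundary_integral :: "(complex \<Rightarrow> complex) \<Rightarrow> complex" where
  "sector_boundary_integral F =
     (LINT r:{0<..}|lborel. F (of_real r * cis (pi / 4)) * cis (pi / 4)) -
     (LINT r:{0<..}|lborel. F (of_real r * cis (3 * pi / 4)) * cis (3 * pi / 4))"

text \<open>\<open>t_transform f \<kappa> t\<close> is \<open>\<integral>\<^sub>0\<^sup>t exp (\<kappa> z) f(z) dz\<close>; it is used with \<open>\<kappa> = k\<^sup>2\<close>.\<close>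

definition t_transform :: "(real \<Rightarrow> complex) \<Rightarrow> complex \<Rightarrow> real \<Rightarrow> complex" where
  "t_transform f \<kappa> t = (LINT z|lebesgue_on {0<..<t}. exp (\<kappa> * of_real z) * f z)"

definition right_half_line_solution :: "(real \<Rightarrow> complex) \<Rightarrow> real \<Rightarrow> real \<Rightarrow> complex" where
  "right_half_line_solution a x t =
     1 / (\<i> * of_real pi) * sector_boundary_integral
       (\<lambda>k. exp (\<i> * k * of_real x - k\<^sup>2 * of_real t) * k * t_transform a (k\<^sup>2) t)"

definition left_half_line_solution :: "real \<Rightarrow> (real \<Rightarrow> complex) \<Rightarrow> real \<Rightarrow> real \<Rightarrow> complex" where
  "left_half_line_solution l b x t =
     1 / (\<i> * of_real pi) * sector_boundary_integral
       (\<lambda>k. exp (\<i> * k * of_real (l - x) - k\<^sup>2 * of_real t) * k * t_transform b (k\<^sup>2) t)"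

definition interval_solution :: "real \<Rightarrow> (real \<Rightarrow> complex) \<Rightarrow> real \<Rightarrow> real \<Rightarrow> complex" where
  "interval_solution l g x t =
     1 / (\<i> * of_real pi) * sector_boundary_integral
       (\<lambda>k. sin (k * of_real (l - x)) / sin (k * of_real l) *
            exp (- (k\<^sup>2 * of_real t)) * k * t_transform g (k\<^sup>2) t)"

end

theory Submission
  imports Defs "HOL-Probability.Characteristic_Functions" "HOL-Probability.Sinc_Integral"
    "HOL-Real_Asymp.Real_Asymp"
begin

text \<open>Parametrising the boundary of the sector by \<open>k\<^sup>2 = \<i> \<tau>\<close> with \<open>\<tau>\<close> real turns each solution formula into a
  convolution in time of the boundary datum with the inverse Fourier transform of a symbol:
  \<open>e x \<tau> = exp (\<i> k x)\<close> for the half-line problems, and \<open>(e x - e (2 l - x)) / (1 - e (2 l))\<close> for the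
  interval. These kernels are causal (they vanish for negative times), so truncated convolutions of
  kernels correspond to products of symbols, in particular \<open>e x * e y = e (x + y)\<close>. The matching
  conditions are then solved by the geometric series \<open>r y = e y / (1 - e (2 l))\<close>: with \<open>G\<close> the Fourier
  transform of \<open>g\<close> over the interval, \<open>a\<close> is \<open>g\<close> plus the inverse transform of \<open>r (2 l) * G\<close>, and \<open>b\<close> is minus
  that of \<open>r l * G\<close>. As \<open>r y\<close> decays faster than any power, both corrections are smooth on the whole line,
  whatever \<open>g\<close> is, and \<open>a\<close>, \<open>b\<close> inherit the regularity of \<open>g\<close>.\<close>

section \<open>The inverse Fourier transform\<close>

text \<open>With A, B for the transforms of \<open>a\<close>, \<open>b\<close>, the matching
  conditions read A = G - e l * B and B = - e l * A. Hence A = G / (1 - e (2 l)) and B = - r l * G,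
  and e x * A + e (l - x) * B is the interval symbol times G. The factor 1 / (1 - e (2 l)) tends to
  1 at infinity, so it is not integrable and has no kernel function; this is why \<open>a\<close> is
  written as \<open>g\<close> plus a correction with symbol r (2 l). That symbol is integrable in
  spite of its singularity of order \<open>\<bar>\<tau>\<bar> powr (-1/2)\<close> at 0. Causality
  carries the argument: the formulae at time t use the data on (0,t) only, whereas G uses all of
  (0,T) and the corrections live on the whole line. The vanishing of the kernels at nonpositive
  times reconciles these ranges. It is obtained from a differential equation in x for integrals
  along the two rays, without deforming a contour.\<close>

lemma borel_measurable_cis [measurable]: "cis \<in> borel_measurable borel"
  by (intro borel_measurable_continuous_onI) (simp add: cis_conv_exp continuous_intros)

section \<open>Differentiation under the integral sign\<close>

lemma has_vector_derivative_iff_quotient: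
  fixes f :: "real \<Rightarrow> 'a::real_normed_vector"
  shows "(f has_vector_derivative D) (at x) \<longleftrightarrow>
    ((\<lambda>y. (1 / (y - x)) *\<^sub>R (f y - f x)) \<longlongrightarrow> D) (at x)"
proof -
  have "norm ((1 / (y - x)) *\<^sub>R (f y - f x) - D) =
      norm (f y - f x - (y - x) *\<^sub>R D) / norm (y - x)" if "y \<noteq> x" for y
  proof -
    have "(1 / (y - x)) *\<^sub>R (f y - f x) - D = (1 / (y - x)) *\<^sub>R (f y - f x - (y - x) *\<^sub>R D)"
      using that by (simp add: scaleR_diff_right)
    then show ?thesis by simp
  qed
  then have "((\<lambda>y. norm ((1 / (y - x)) *\<^sub>R (f y - f x) - D)) \<longlongrightarrow> 0) (at x) \<longleftrightarrow>
      ((\<lambda>y. norm (f y - f x - (y - x) *\<^sub>R D) / norm (y - x)) \<longlongrightarrow> 0) (at x)"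
    by (intro filterlim_cong refl) (auto simp: eventually_at_filter)
  then show ?thesis
    unfolding has_vector_derivative_def has_derivative_iff_norm
    by (simp add: bounded_linear_scaleR_left tendsto_norm_zero_iff LIM_zero_iff)
qed

text \<open>On the convex set \<open>S\<close> the mean value inequality bounds every difference
  quotient by \<open>w\<close>, so dominated convergence applies along each sequence tending to
  \<open>x0\<close>.\<close>

lemma has_vector_derivative_integral_param:
  fixes f f' :: "real \<Rightarrow> 'a \<Rightarrow> complex"
  assumes S: "open S" "convex S" "x0 \<in> S"
    and int: "\<And>x. x \<in> S \<Longrightarrow> integrable M (f x)"
    and deriv: "\<And>x y. x \<in> S \<Longrightarrow> y \<in> space M \<Longrightarrow>
      ((\<lambda>x. f x y) has_vector_derivative f' x y) (at x)"
    and meas: "f' x0 \<in> borel_measurable M"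
    and bound: "\<And>x y. x \<in> S \<Longrightarrow> y \<in> space M \<Longrightarrow> norm (f' x y) \<le> w y"
    and w: "integrable M w"
  shows "((\<lambda>x. LINT y|M. f x y) has_vector_derivative (LINT y|M. f' x0 y)) (at x0)"
proof -
  have "((\<lambda>x. (1 / (x - x0)) *\<^sub>R ((LINT y|M. f x y) - (LINT y|M. f x0 y)))
      \<longlongrightarrow> (LINT y|M. f' x0 y)) (at x0)"
    unfolding tendsto_at_iff_sequentially comp_def
  proof (intro allI impI)
    fix X :: "nat \<Rightarrow> real"
    assume X: "\<forall>i. X i \<in> UNIV - {x0}" and lim: "X \<longlonglongrightarrow> x0"
    obtain N where N: "\<And>n. n \<ge> N \<Longrightarrow> X n \<in> S"
      using topological_tendstoD[OF lim S(1,3)] by (auto simp: eventually_sequentially)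
    \<comment> \<open>The tail of the sequence, which lies in \<open>S\<close> where the bound is
      available.\<close>
    define Y where "Y n = X (n + N)" for n
    have YS: "Y n \<in> S" and Yne: "Y n \<noteq> x0" for n
      using N[of "n + N"] X by (auto simp: Y_def)
    have Ylim: "Y \<longlonglongrightarrow> x0"
      unfolding Y_def using lim by (rule LIMSEQ_ignore_initial_segment)
    have "(\<lambda>n. LINT y|M. (1 / (Y n - x0)) *\<^sub>R (f (Y n) y - f x0 y)) \<longlonglongrightarrow> (LINT y|M. f' x0 y)"
    proof (rule integral_dominated_convergence[where w = w])
      show "f' x0 \<in> borel_measurable M" by fact
      show "(\<lambda>y. (1 / (Y n - x0)) *\<^sub>R (f (Y n) y - f x0 y)) \<in> borel_measurable M" for n
        using int[OF YS[of n]] int[OF S(3)] by measurable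
      show "integrable M w" by fact
      show "AE y in M. (\<lambda>n. (1 / (Y n - x0)) *\<^sub>R (f (Y n) y - f x0 y)) \<longlonglongrightarrow> f' x0 y"
      proof (rule AE_I2)
        fix y assume "y \<in> space M"
        from deriv[OF S(3) this]
        have "((\<lambda>x. (1 / (x - x0)) *\<^sub>R (f x y - f x0 y)) \<longlongrightarrow> f' x0 y) (at x0)"
          by (simp only: has_vector_derivative_iff_quotient)
        then show "(\<lambda>n. (1 / (Y n - x0)) *\<^sub>R (f (Y n) y - f x0 y)) \<longlonglongrightarrow> f' x0 y"
          using Ylim Yne unfolding tendsto_at_iff_sequentially comp_def by auto
      qed
      show "AE y in M. norm ((1 / (Y n - x0)) *\<^sub>R (f (Y n) y - f x0 y)) \<le> w y" for n
      proof (rule AE_I2)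
        fix y assume y: "y \<in> space M"
        have "norm (f (Y n) y - f x0 y) \<le> w y * norm (Y n - x0)"
        proof (rule differentiable_bound[OF S(2) _ _ YS S(3)])
          fix x assume x: "x \<in> S"
          show "((\<lambda>x. f x y) has_derivative (\<lambda>h. h *\<^sub>R f' x y)) (at x within S)"
            using deriv[OF x y] by (simp add: has_vector_derivative_def has_derivative_at_withinI)
          show "onorm (\<lambda>h. h *\<^sub>R f' x y) \<le> w y"
            by (rule onorm_le) (use bound[OF x y] in \<open>simp add: mult.commute mult_left_mono\<close>)
        qed
        then show "norm ((1 / (Y n - x0)) *\<^sub>R (f (Y n) y - f x0 y)) \<le> w y"
          using Yne[of n] unfolding norm_scaleR by (simp add: field_simps)
      qed
    qed
    then have "(\<lambda>n. (1 / (Y n - x0)) *\<^sub>R ((LINT y|M. f (Y n) y) - (LINT y|M. f x0 y)))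
        \<longlonglongrightarrow> (LINT y|M. f' x0 y)"
      using int[OF YS] int[OF S(3)] by simp
    then show "(\<lambda>n. (1 / (X n - x0)) *\<^sub>R ((LINT y|M. f (X n) y) - (LINT y|M. f x0 y)))
        \<longlonglongrightarrow> (LINT y|M. f' x0 y)"
      unfolding Y_def by (rule LIMSEQ_offset)
  qed
  then show ?thesis
    by (simp only: has_vector_derivative_iff_quotient)
qed

definition inv_fourier :: "(real \<Rightarrow> complex) \<Rightarrow> real \<Rightarrow> complex" where
  "inv_fourier H s = 1 / (2 * of_real pi) * (LINT \<tau>|lborel. cis (- (\<tau> * s)) * H \<tau>)"

lemma integrable_bounded_mult:
  fixes H u :: "'a \<Rightarrow> complex"
  assumes "integrable M H" "u \<in> borel_measurable M" "\<And>x. x \<in> space M \<Longrightarrow> norm (u x) \<le> C"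
  shows "integrable M (\<lambda>x. u x * H x)"
proof (rule Bochner_Integration.integrable_bound)
  show "integrable M (\<lambda>x. C * norm (H x))" using assms by auto
  show "(\<lambda>x. u x * H x) \<in> borel_measurable M" using assms by measurable
  show "AE x in M. norm (u x * H x) \<le> norm (C * norm (H x))"
    using assms(3) by (intro AE_I2) (smt (verit) abs_norm_cancel abs_mult mult_right_mono norm_ge_zero norm_mult real_norm_def)
qed

lemma integrable_cis_mult:
  assumes "integrable M H" "p \<in> borel_measurable M"
  shows "integrable M (\<lambda>x. cis (p x) * H x)"
  using assms by (intro integrable_bounded_mult[where C = 1]) auto

lemma norm_inv_fourier_le:
  "norm (inv_fourier H s) \<le> 1 / (2 * pi) * (LINT \<tau>|lborel. norm (H \<tau>))"
proof -
  have "norm (LINT \<tau>|lborel. cis (- (\<tau> * s)) * H \<tau>) \<le> (LINT \<tau>|lborel. norm (cis (- (\<tau> * s)) * H \<tau>))"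
    by (rule integral_norm_bound)
  then show ?thesis
    by (simp add: inv_fourier_def norm_mult norm_divide divide_right_mono)
qed

lemma has_vector_derivative_cis_mult:
  "((\<lambda>s. cis (- (a * s))) has_vector_derivative (- (\<i> * of_real a) * cis (- (a * s)))) (at s)"
  unfolding cis_conv_exp
  by (auto intro!: derivative_eq_intros has_vector_derivative_real_field simp: field_simps)

lemma inv_fourier_has_vector_derivative:
  assumes H: "integrable lborel H" and H1: "integrable lborel (\<lambda>\<tau>. of_real \<tau> * H \<tau>)"
  shows "(inv_fourier H has_vector_derivative inv_fourier (\<lambda>\<tau>. - \<i> * of_real \<tau> * H \<tau>) s) (at s)"
proof -
  have [measurable]: "H \<in> borel_measurable borel" using H by auto
  have "((\<lambda>s. LINT \<tau>|lborel. cis (- (\<tau> * s)) * H \<tau>) has_vector_derivative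
      (LINT \<tau>|lborel. - (\<i> * of_real \<tau>) * cis (- (\<tau> * s)) * H \<tau>)) (at s)"
  proof (rule has_vector_derivative_integral_param[where S = UNIV and w = "\<lambda>\<tau>. norm (of_real \<tau> * H \<tau>)"])
    show "((\<lambda>s. cis (- (\<tau> * s)) * H \<tau>) has_vector_derivative
        - (\<i> * of_real \<tau>) * cis (- (\<tau> * s)) * H \<tau>) (at s)" for s \<tau>
      by (intro has_vector_derivative_mult_left has_vector_derivative_cis_mult)
    show "integrable lborel (\<lambda>\<tau>. norm (of_real \<tau> * H \<tau>))"
      using H1 by (rule integrable_norm)
  qed (use H in \<open>auto intro!: integrable_cis_mult simp: norm_mult\<close>)
  from has_vector_derivative_mult_right[OF this, of "1 / (2 * of_real pi)"] show ?thesis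
    unfolding inv_fourier_def by (simp only: mult_ac mult_minus_left mult_minus_right)
qed

lemma continuous_inv_fourier:
  assumes H: "integrable lborel H"
  shows "continuous_on UNIV (inv_fourier H)"
proof -
  have [measurable]: "H \<in> borel_measurable borel" using H by auto
  have "isCont (\<lambda>s. LINT \<tau>|lborel. cis (- (\<tau> * s)) * H \<tau>) x" for x
    unfolding continuous_at_sequentially comp_def
  proof (intro allI impI)
    fix X :: "nat \<Rightarrow> real" assume lim: "X \<longlonglongrightarrow> x"
    show "(\<lambda>n. LINT \<tau>|lborel. cis (- (\<tau> * X n)) * H \<tau>) \<longlonglongrightarrow> (LINT \<tau>|lborel. cis (- (\<tau> * x)) * H \<tau>)"
    proof (rule integral_dominated_convergence[where w = "\<lambda>\<tau>. norm (H \<tau>)"])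
      show "AE \<tau> in lborel. (\<lambda>n. cis (- (\<tau> * X n)) * H \<tau>) \<longlonglongrightarrow> cis (- (\<tau> * x)) * H \<tau>"
        unfolding cis_conv_exp using lim by (intro AE_I2 tendsto_intros)
    qed (use H in \<open>auto simp: norm_mult\<close>)
  qed
  then show ?thesis
    unfolding inv_fourier_def
    by (intro continuous_at_imp_continuous_on ballI) (auto intro!: continuous_intros)
qed

lemma borel_measurable_inv_fourier [measurable]:
  "integrable lborel H \<Longrightarrow> inv_fourier H \<in> borel_measurable borel"
  by (intro borel_measurable_continuous_onI continuous_inv_fourier)

text \<open>Fubini: the double integrand has modulus |H \<tau>| |f z|. \<open>M\<close> and
  \<open>p\<close> are general because the lemma serves both \<open>lborel\<close> and Lebesgue
  measure on an interval, with p z = z or p z = t - z.\<close>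

lemma integral_inv_fourier_mult:
  fixes f :: "'a \<Rightarrow> complex"
  assumes M: "sigma_finite_measure M" and H: "integrable lborel H" and f: "integrable M f"
    and p: "p \<in> borel_measurable M"
  shows "(LINT z|M. inv_fourier H (p z) * f z) =
    1 / (2 * of_real pi) * (LINT \<tau>|lborel. H \<tau> * (LINT z|M. cis (- (\<tau> * p z)) * f z))"
    and "integrable lborel (\<lambda>\<tau>. H \<tau> * (LINT z|M. cis (- (\<tau> * p z)) * f z))"
proof -
  interpret M: sigma_finite_measure M by fact
  interpret pair_sigma_finite M lborel ..
  have [measurable]: "H \<in> borel_measurable borel" "f \<in> borel_measurable M" "p \<in> borel_measurable M"
    using H f p by auto
  have int: "integrable (M \<Otimes>\<^sub>M lborel) (\<lambda>(z, \<tau>). cis (- (\<tau> * p z)) * H \<tau> * f z)"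
  proof (rule Fubini_integrable)
    have "(LINT \<tau>|lborel. norm (cis (- (\<tau> * p z)) * H \<tau> * f z)) = (LINT \<tau>|lborel. norm (H \<tau>)) * norm (f z)" for z
      by (simp add: norm_mult)
    then show "integrable M (\<lambda>z. LINT \<tau>|lborel. norm (case (z, \<tau>) of (z, \<tau>) \<Rightarrow> cis (- (\<tau> * p z)) * H \<tau> * f z))"
      using f by simp
    show "AE z in M. integrable lborel (\<lambda>\<tau>. case (z, \<tau>) of (z, \<tau>) \<Rightarrow> cis (- (\<tau> * p z)) * H \<tau> * f z)"
      using integrable_mult_left[OF integrable_cis_mult[OF H, of "\<lambda>\<tau>. - (\<tau> * p z)" for z]] by simp
  qed measurable
  have pull: "(LINT z|M. cis (- (\<tau> * p z)) * H \<tau> * f z) = H \<tau> * (LINT z|M. cis (- (\<tau> * p z)) * f z)" for \<tau>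
    by (subst integral_mult_right_zero [symmetric]) (simp only: mult_ac)
  have "(LINT z|M. inv_fourier H (p z) * f z) =
      (LINT z|M. 1 / (2 * of_real pi) * (LINT \<tau>|lborel. cis (- (\<tau> * p z)) * H \<tau> * f z))"
    by (simp add: inv_fourier_def)
  also have "\<dots> = 1 / (2 * of_real pi) * (LINT z|M. (LINT \<tau>|lborel. cis (- (\<tau> * p z)) * H \<tau> * f z))"
    by (rule integral_mult_right_zero)
  also have "(LINT z|M. (LINT \<tau>|lborel. cis (- (\<tau> * p z)) * H \<tau> * f z)) =
      (LINT \<tau>|lborel. (LINT z|M. cis (- (\<tau> * p z)) * H \<tau> * f z))"
    using Fubini_integral[OF int] by simp
  finally show "(LINT z|M. inv_fourier H (p z) * f z) =
    1 / (2 * of_real pi) * (LINT \<tau>|lborel. H \<tau> * (LINT z|M. cis (- (\<tau> * p z)) * f z))"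
    by (simp only: pull)
  have "integrable lborel (\<lambda>\<tau>. (LINT z|M. cis (- (\<tau> * p z)) * H \<tau> * f z))"
    using integrable_snd[OF int] by simp
  then show "integrable lborel (\<lambda>\<tau>. H \<tau> * (LINT z|M. cis (- (\<tau> * p z)) * f z))"
    by (simp only: pull)
qed

section \<open>Convolution of causal kernels\<close>

lemma char_std_normal_cis:
  "(LINT v|lborel. cis (\<omega> * v) * of_real (std_normal_density v)) = exp (- \<omega>\<^sup>2 / 2)"
proof -
  have "char std_normal_distribution \<omega> = (LINT v|lborel. std_normal_density v *\<^sub>R exp (\<i> * complex_of_real (\<omega> * v)))"
    unfolding char_def by (subst integral_density) auto
  also have "\<dots> = (LINT v|lborel. cis (\<omega> * v) * of_real (std_normal_density v))"
    by (simp add: cis_conv_exp scaleR_conv_of_real mult.commute)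
  finally show ?thesis
    by (simp add: char_std_normal_distribution)
qed

lemma integrable_gaussian:
  fixes c :: real
  assumes "c > 0"
  shows "integrable lborel (\<lambda>u. exp (- (u / c)\<^sup>2 / 2))"
proof -
  have "integrable lborel (\<lambda>u. sqrt (2 * pi) * std_normal_density (0 + (1 / c) * u))"
    using assms by (intro integrable_mult_right lborel_integrable_real_affine) auto
  then show ?thesis
    by (simp add: std_normal_density_def)
qed

text \<open>Substituting u = c v reduces this to the characteristic function of the normal
  distribution. The right-hand side is 2 pi times a normal density in \<omega> of width 1 / c, and
  the 2 pi cancels against the prefactor of \<open>inv_fourier\<close>.\<close>

lemma fourier_gaussian:
  fixes c \<omega> :: real
  assumes c: "c > 0"
  shows "(LINT u|lborel. cis (\<omega> * u) * of_real (exp (- (u / c)\<^sup>2 / 2))) =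
    of_real (c * (2 * pi) * std_normal_density (\<omega> * c))"
proof -
  have "(LINT u|lborel. cis (\<omega> * u) * of_real (exp (- (u / c)\<^sup>2 / 2))) =
      c *\<^sub>R (LINT v|lborel. cis (\<omega> * (0 + c * v)) * of_real (exp (- ((0 + c * v) / c)\<^sup>2 / 2)))"
    using c by (subst lborel_integral_real_affine[where c = c and t = 0]) auto
  also have "(LINT v|lborel. cis (\<omega> * (0 + c * v)) * of_real (exp (- ((0 + c * v) / c)\<^sup>2 / 2))) =
      (LINT v|lborel. sqrt (2 * pi) * (cis ((\<omega> * c) * v) * of_real (std_normal_density v)))"
    using c by (intro Bochner_Integration.integral_cong) (simp_all add: std_normal_density_def mult_ac)
  also have "\<dots> = sqrt (2 * pi) * exp (- (\<omega> * c)\<^sup>2 / 2)"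
    by (simp only: integral_mult_right_zero char_std_normal_cis) simp
  finally have "(LINT u|lborel. cis (\<omega> * u) * of_real (exp (- (u / c)\<^sup>2 / 2))) =
      of_real (c * (sqrt (2 * pi) * exp (- (\<omega> * c)\<^sup>2 / 2)))"
    by (simp add: scaleR_conv_of_real)
  also have "c * (sqrt (2 * pi) * exp (- (\<omega> * c)\<^sup>2 / 2)) = c * (2 * pi) * std_normal_density (\<omega> * c)"
    by (simp add: std_normal_density_def real_div_sqrt field_simps)
  finally show ?thesis .
qed

lemma integral_lebesgue_on_eq_lborel:
  fixes f :: "real \<Rightarrow> complex"
  assumes [measurable]: "f \<in> borel_measurable borel" and "\<And>z. z \<notin> S \<Longrightarrow> f z = 0" and "S \<in> sets borel"
  shows "(LINT z|lebesgue_on S. f z) = (LINT z|lborel. f z)"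
proof -
  have "(LINT z|lebesgue_on S. f z) = (LINT z|lebesgue. indicator S z *\<^sub>R f z)"
    using assms(3) by (intro integral_restrict_space) auto
  also have "\<dots> = (LINT z|lebesgue. f z)"
    using assms(2) by (intro Bochner_Integration.integral_cong) (auto split: split_indicator)
  also have "\<dots> = (LINT z|lborel. f z)"
    by (rule integral_completion) measurable
  finally show ?thesis .
qed

text \<open>The Gaussian means \<open>P n\<close> of \<open>F\<close> are what the Fourier transform of the Gaussian-damped
  \<open>inv_fourier F\<close> computes; undoing the damping needs no integrability of \<open>inv_fourier F\<close>,
  because causality confines the convolution to a bounded interval.\<close>

lemma causal_convolution:
  assumes H: "integrable lborel H" and H0: "\<And>s. s \<le> 0 \<Longrightarrow> inv_fourier H s = 0"
    and F: "integrable lborel F" and F0: "\<And>s. s \<le> 0 \<Longrightarrow> inv_fourier F s = 0"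
    and F1: "continuous_on UNIV F" "\<And>\<tau>. norm (F \<tau>) \<le> 1"
  shows "(LINT z|lebesgue_on {0<..<t}. inv_fourier F (t - z) * inv_fourier H z) =
    inv_fourier (\<lambda>\<tau>. H \<tau> * F \<tau>) t"
proof -
  define C where "C K = 1 / (2 * pi) * (LINT \<tau>|lborel. norm (K \<tau>))" for K :: "real \<Rightarrow> complex"
  have bnd: "norm (inv_fourier K s) \<le> C K" for K s
    unfolding C_def by (rule norm_inv_fourier_le)
  have [measurable]: "H \<in> borel_measurable borel" "F \<in> borel_measurable borel"
    "inv_fourier F \<in> borel_measurable borel" "inv_fourier H \<in> borel_measurable borel"
    using H F by auto
  \<comment> \<open>The width of the damping Gaussian; it tends to infinity and is positive from n =
    0 on.\<close>
  define c where "c n = real n + 1" for n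
  have c: "c n > 0" for n by (simp add: c_def)
  have c_lim: "(\<lambda>n. a / c n) \<longlonglongrightarrow> 0" for a
    unfolding c_def by real_asymp
  define \<gamma> where "\<gamma> n u = complex_of_real (exp (- (u / c n)\<^sup>2 / 2))" for n u
  have [measurable]: "\<gamma> n \<in> borel_measurable borel" for n unfolding \<gamma>_def by measurable
  have \<gamma>_int: "integrable lborel (\<gamma> n)" for n
    unfolding \<gamma>_def using integrable_gaussian[OF c, of n] by simp
  define P where "P n \<tau> = (LINT v|lborel. F (\<tau> + v / c n) * of_real (std_normal_density v))" for n \<tau>
  have [measurable]: "P n \<in> borel_measurable borel" for n unfolding P_def by measurable
  have FN: "integrable lborel (\<lambda>v. F (p v) * of_real (std_normal_density v))"
    if [measurable]: "p \<in> borel_measurable borel" for p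
    by (rule integrable_bounded_mult[where C = 1]) (use F1 in auto)
  have P_le: "norm (P n \<tau>) \<le> 1" for n \<tau>
  proof -
    have "norm (P n \<tau>) \<le> (LINT v|lborel. norm (F (\<tau> + v / c n) * of_real (std_normal_density v)))"
      unfolding P_def by (rule integral_norm_bound)
    also have "\<dots> \<le> (LINT v|lborel. std_normal_density v)"
      by (rule integral_mono[OF integrable_norm[OF FN]])
        (use F1(2) in \<open>auto simp: norm_mult intro!: mult_left_le_one_le\<close>)
    finally show ?thesis by simp
  qed
  have P_lim: "(\<lambda>n. P n \<tau>) \<longlonglongrightarrow> F \<tau>" for \<tau>
  proof -
    have "(\<lambda>n. P n \<tau>) \<longlonglongrightarrow> (LINT v|lborel. F \<tau> * of_real (std_normal_density v))"
      unfolding P_def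
    proof (rule integral_dominated_convergence[where w = std_normal_density])
      have "isCont F \<tau>" using F1(1) by (simp add: continuous_on_eq_continuous_at)
      moreover have "(\<lambda>n. \<tau> + v / c n) \<longlonglongrightarrow> \<tau>" for v
        using tendsto_add[OF tendsto_const c_lim] by simp
      ultimately show "AE v in lborel. (\<lambda>n. F (\<tau> + v / c n) * of_real (std_normal_density v))
          \<longlonglongrightarrow> F \<tau> * of_real (std_normal_density v)"
        by (intro AE_I2 tendsto_mult tendsto_const isCont_tendsto_compose[of \<tau> F])
    qed (use F1(2) in \<open>auto simp: norm_mult intro!: mult_left_le_one_le\<close>)
    then show ?thesis by simp
  qed

  \<comment> \<open>Fubini twice: inside, for \<open>F\<close> against the integrable damping
    \<open>\<gamma> n\<close>; outside, for \<open>H\<close> against the damped kernel of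
    \<open>F\<close>.\<close>
  have step: "(LINT u|lborel. inv_fourier F u * \<gamma> n u * inv_fourier H (t - u)) =
      1 / (2 * of_real pi) * (LINT \<tau>|lborel. H \<tau> * (cis (- (\<tau> * t)) * P n \<tau>))" for n
  proof -
    have int: "integrable lborel (\<lambda>u. inv_fourier F u * \<gamma> n u)"
      by (rule integrable_bounded_mult[where C = "C F"]) (use \<gamma>_int bnd in auto)
    have inner: "(LINT u|lborel. cis (- (\<tau> * (t - u))) * (inv_fourier F u * \<gamma> n u)) = cis (- (\<tau> * t)) * P n \<tau>" for \<tau>
    proof -
      have "(LINT u|lborel. cis (- (\<tau> * (t - u))) * (inv_fourier F u * \<gamma> n u)) =
          (LINT u|lborel. cis (- (\<tau> * t)) * (inv_fourier F u * (cis (\<tau> * u) * \<gamma> n u)))"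
        by (intro Bochner_Integration.integral_cong) (simp_all add: cis_mult algebra_simps flip: cis_divide)
      also have "\<dots> = cis (- (\<tau> * t)) * (LINT u|lborel. inv_fourier F u * (cis (\<tau> * u) * \<gamma> n u))"
        by (rule integral_mult_right_zero)
      also have "(LINT u|lborel. inv_fourier F u * (cis (\<tau> * u) * \<gamma> n u)) =
          1 / (2 * of_real pi) * (LINT \<sigma>|lborel. F \<sigma> * (LINT u|lborel. cis (- (\<sigma> * u)) * (cis (\<tau> * u) * \<gamma> n u)))"
        by (rule integral_inv_fourier_mult)
          (use F \<gamma>_int in \<open>auto intro!: integrable_cis_mult lborel.sigma_finite_measure_axioms\<close>)
      also have "(\<lambda>\<sigma>. LINT u|lborel. cis (- (\<sigma> * u)) * (cis (\<tau> * u) * \<gamma> n u)) =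
          (\<lambda>\<sigma>. of_real (c n * (2 * pi) * std_normal_density ((\<tau> - \<sigma>) * c n)))"
        unfolding \<gamma>_def fourier_gaussian[OF c, symmetric]
        by (intro ext Bochner_Integration.integral_cong) (simp_all add: cis_mult algebra_simps flip: mult.assoc)
      \<comment> \<open>The substitution \<sigma> = \<tau> + v / c n turns the narrow density around
        \<tau> into the standard one.\<close>
      also have "(LINT \<sigma>|lborel. F \<sigma> * of_real (c n * (2 * pi) * std_normal_density ((\<tau> - \<sigma>) * c n))) =
          (1 / c n) *\<^sub>R (LINT v|lborel. F (\<tau> + (1 / c n) * v) *
            of_real (c n * (2 * pi) * std_normal_density ((\<tau> - (\<tau> + (1 / c n) * v)) * c n)))"
        using c[of n] by (subst lborel_integral_real_affine[where c = "1 / c n" and t = \<tau>]) auto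
      also have "(LINT v|lborel. F (\<tau> + (1 / c n) * v) *
            of_real (c n * (2 * pi) * std_normal_density ((\<tau> - (\<tau> + (1 / c n) * v)) * c n))) =
          (LINT v|lborel. of_real (c n * (2 * pi)) * (F (\<tau> + v / c n) * of_real (std_normal_density v)))"
        using c[of n] by (intro Bochner_Integration.integral_cong) (simp_all add: std_normal_density_def field_simps)
      also have "\<dots> = of_real (c n * (2 * pi)) * P n \<tau>"
        unfolding P_def by (rule integral_mult_right_zero)
      finally show ?thesis
        using c[of n] by (simp add: scaleR_conv_of_real)
    qed
    have "(LINT u|lborel. inv_fourier F u * \<gamma> n u * inv_fourier H (t - u)) =
        (LINT u|lborel. inv_fourier H (t - u) * (inv_fourier F u * \<gamma> n u))"
      by (simp only: mult.commute)
    also have "\<dots> = 1 / (2 * of_real pi) * (LINT \<tau>|lborel. H \<tau> *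
        (LINT u|lborel. cis (- (\<tau> * (t - u))) * (inv_fourier F u * \<gamma> n u)))"
      by (rule integral_inv_fourier_mult) (use H int in \<open>auto intro: lborel.sigma_finite_measure_axioms\<close>)
    finally show ?thesis
      by (simp only: inner)
  qed
  \<comment> \<open>Both kernels vanish at nonpositive arguments, so the integrand is supported in
    \<open>{0..t}\<close> and a constant on that interval is an integrable majorant.\<close>
  have "(\<lambda>n. LINT u|lborel. inv_fourier F u * \<gamma> n u * inv_fourier H (t - u)) \<longlonglongrightarrow>
      (LINT u|lborel. inv_fourier F u * inv_fourier H (t - u))"
  proof (rule integral_dominated_convergence[where w = "\<lambda>u. indicator {0..t} u *\<^sub>R (C F * C H)"])
    have "(\<lambda>n. \<gamma> n u) \<longlonglongrightarrow> of_real (exp (- 0\<^sup>2 / 2))" for u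
      unfolding \<gamma>_def by (intro tendsto_intros c_lim) simp
    then show "AE u in lborel. (\<lambda>n. inv_fourier F u * \<gamma> n u * inv_fourier H (t - u)) \<longlonglongrightarrow>
        inv_fourier F u * inv_fourier H (t - u)"
      by (intro AE_I2) (auto intro!: tendsto_eq_intros)
    show "AE u in lborel. norm (inv_fourier F u * \<gamma> n u * inv_fourier H (t - u)) \<le>
        indicator {0..t} u *\<^sub>R (C F * C H)" for n
    proof (rule AE_I2)
      fix u
      have "norm (\<gamma> n u) \<le> 1" by (simp add: \<gamma>_def)
      then have "norm (inv_fourier F u) * norm (\<gamma> n u) * norm (inv_fourier H (t - u)) \<le> C F * 1 * C H"
        by (intro mult_mono bnd mult_nonneg_nonneg norm_ge_zero) (auto simp: C_def)
      then show "norm (inv_fourier F u * \<gamma> n u * inv_fourier H (t - u)) \<le> indicator {0..t} u *\<^sub>R (C F * C H)"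
        using F0[of u] H0[of "t - u"] by (auto simp: norm_mult split: split_indicator)
    qed
    show "integrable lborel (\<lambda>u. indicat_real {0..t} u *\<^sub>R (C F * C H))"
      by (intro integrable_indicator) (auto simp: emeasure_lborel_Icc_eq)
  qed auto
  \<comment> \<open>On the transform side the Gaussian means are bounded by 1, so |H| is the
    majorant.\<close>
  moreover have "(\<lambda>n. LINT u|lborel. inv_fourier F u * \<gamma> n u * inv_fourier H (t - u)) \<longlonglongrightarrow>
      1 / (2 * of_real pi) * (LINT \<tau>|lborel. H \<tau> * (cis (- (\<tau> * t)) * F \<tau>))"
    unfolding step
  proof (intro tendsto_mult tendsto_const integral_dominated_convergence[where w = "\<lambda>\<tau>. norm (H \<tau>)"])
    show "AE \<tau> in lborel. (\<lambda>n. H \<tau> * (cis (- (\<tau> * t)) * P n \<tau>)) \<longlonglongrightarrow> H \<tau> * (cis (- (\<tau> * t)) * F \<tau>)"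
      by (intro AE_I2 tendsto_mult tendsto_const P_lim)
    show "AE \<tau> in lborel. norm (H \<tau> * (cis (- (\<tau> * t)) * P n \<tau>)) \<le> norm (H \<tau>)" for n
      using P_le by (intro AE_I2) (auto simp: norm_mult mult_left_le)
  qed (use H in auto)
  ultimately have eq: "(LINT u|lborel. inv_fourier F u * inv_fourier H (t - u)) =
      inv_fourier (\<lambda>\<tau>. H \<tau> * F \<tau>) t"
    unfolding inv_fourier_def[of "\<lambda>\<tau>. H \<tau> * F \<tau>"]
    by (simp add: LIMSEQ_unique mult_ac)
  have "(LINT z|lebesgue_on {0<..<t}. inv_fourier F (t - z) * inv_fourier H z) =
      (LINT z|lborel. inv_fourier F (t - z) * inv_fourier H z)"
    by (rule integral_lebesgue_on_eq_lborel) (use F0 H0 in \<open>auto simp: not_less\<close>)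
  also have "\<dots> = (LINT u|lborel. inv_fourier F u * inv_fourier H (t - u))"
    by (subst lborel_integral_real_affine[where c = "-1" and t = t]) auto
  finally show ?thesis using eq by simp
qed

section \<open>The symbol of the half-line problem\<close>

text \<open>The square root of \<open>\<i> \<tau>\<close> in the closed upper half plane; the real \<open>sqrt\<close> is odd, so positive and
  negative \<open>\<tau>\<close> give the rays \<open>arg k = \<pi>/4\<close> and \<open>arg k = 3\<pi>/4\<close>.\<close>

definition root_i :: "real \<Rightarrow> complex" where
  "root_i \<tau> = Complex (sqrt (\<tau> / 2)) (sqrt (\<bar>\<tau>\<bar> / 2))"

definition heat_symbol :: "real \<Rightarrow> real \<Rightarrow> complex" where
  "heat_symbol x \<tau> = exp (\<i> * root_i \<tau> * of_real x)"

lemma root_i_power2: "(root_i \<tau>)\<^sup>2 = \<i> * of_real \<tau>"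
proof -
  have "sqrt (\<tau> / 2) * sqrt (\<bar>\<tau>\<bar> / 2) = \<tau> / 2"
    by (cases "\<tau> \<ge> 0") (auto simp: real_sqrt_minus real_sqrt_divide)
  moreover have "(sqrt (\<tau> / 2))\<^sup>2 = \<bar>\<tau>\<bar> / 2"
    by (simp add: power2_eq_square flip: real_sqrt_mult)
  ultimately show ?thesis
    by (simp add: root_i_def complex_eq_iff power2_eq_square mult.commute)
qed

lemma root_i_eq_0_iff: "root_i \<tau> = 0 \<longleftrightarrow> \<tau> = 0"
  by (simp add: root_i_def complex_eq_iff)

lemma root_i_right_ray: "r > 0 \<Longrightarrow> root_i (r\<^sup>2) = of_real r * cis (pi / 4)"
  by (simp add: root_i_def complex_eq_iff cos_45 sin_45 real_sqrt_divide real_div_sqrt field_simps)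

lemma root_i_left_ray: "r > 0 \<Longrightarrow> root_i (- (r\<^sup>2)) = of_real r * cis (3 * pi / 4)"
proof -
  assume r: "r > 0"
  have "3 * pi / 4 = pi - pi / 4" by simp
  then have "cis (3 * pi / 4) = Complex (- (sqrt 2 / 2)) (sqrt 2 / 2)"
    unfolding cis.code by (simp only: cos_pi_minus sin_pi_minus cos_45 sin_45)
  with r show ?thesis
    by (simp only:) (simp add: root_i_def complex_eq_iff real_sqrt_divide real_sqrt_minus real_div_sqrt field_simps)
qed

lemma continuous_heat_symbol: "continuous_on UNIV (heat_symbol x)"
  unfolding heat_symbol_def root_i_def Complex_eq
  by (intro continuous_intros) auto

lemma borel_measurable_heat_symbol [measurable]: "heat_symbol x \<in> borel_measurable borel"
  by (intro borel_measurable_continuous_onI continuous_heat_symbol)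

lemma norm_heat_symbol: "norm (heat_symbol x \<tau>) = exp (- (x * sqrt (\<bar>\<tau>\<bar> / 2)))"
  by (simp add: heat_symbol_def root_i_def mult.commute)

lemma heat_symbol_mult: "heat_symbol x \<tau> * heat_symbol y \<tau> = heat_symbol (x + y) \<tau>"
  by (simp add: heat_symbol_def ring_distribs flip: exp_add)

text \<open>Comparison with 1 / (1 + \<tau>^2), by exp u \<ge> (1 + u / 4)^4 for u =
  \<open>sqrt (\<bar>\<tau>\<bar> / 2)\<close>. Here u^4 = \<tau>^2 / 4, hence (u / 4)^4 = \<tau>^2
  / 1024, which explains the constant.\<close>

lemma integrable_heat_symbol_1: "integrable lborel (\<lambda>\<tau>. norm (heat_symbol 1 \<tau>))"
proof (rule Bochner_Integration.integrable_bound)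
  show "integrable lborel (\<lambda>\<tau>::real. 1024 * inverse (1 + \<tau>\<^sup>2))"
    using integrable_inverse_1_plus_square by (simp add: set_integrable_def)
  show "AE \<tau> in lborel. norm (norm (heat_symbol 1 \<tau>)) \<le> norm (1024 * inverse (1 + \<tau>\<^sup>2))"
  proof (rule AE_I2)
    fix \<tau> :: real
    define u where "u = sqrt (\<bar>\<tau>\<bar> / 2)"
    have u: "u \<ge> 0" "u ^ 4 = \<tau>\<^sup>2 / 4"
      unfolding u_def by (auto simp: real_sqrt_power_even power_divide)
    have "1 + \<tau>\<^sup>2 \<le> 1024 * (1 + u / 4) ^ 4"
    proof -
      have "1 + (u / 4) ^ 4 \<le> (1 + u / 4) ^ 4"
      proof -
        define a where "a = u / 4"
        have "(1 + a) ^ 4 = 1 + a ^ 4 + (4 * a + 6 * a\<^sup>2 + 4 * a ^ 3)" by algebra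
        moreover have "4 * a + 6 * a\<^sup>2 + 4 * a ^ 3 \<ge> 0" using u(1) by (simp add: a_def)
        ultimately show ?thesis by (simp add: a_def)
      qed
      then show ?thesis using u(2) by (simp add: power_divide)
    qed
    also have "\<dots> \<le> 1024 * exp u"
      using exp_ge_one_plus_x_over_n_power_n[of 4 u] u(1) by simp
    finally have "exp (- u) \<le> 1024 * inverse (1 + \<tau>\<^sup>2)"
      by (simp add: exp_minus field_simps add_pos_nonneg)
    then show "norm (norm (heat_symbol 1 \<tau>)) \<le> norm (1024 * inverse (1 + \<tau>\<^sup>2))"
      by (simp add: norm_heat_symbol u_def)
  qed
qed measurable

text \<open>\<open>root_i\<close> is homogeneous of degree 1/2, so all positive x reduce to x = 1.
  The form \<open>0 + x\<^sup>2 * \<tau>\<close> matches the affine substitution rules for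
  \<open>lborel\<close>.\<close>

lemma heat_symbol_scale:
  assumes "x > 0"
  shows "heat_symbol x \<tau> = heat_symbol 1 (0 + x\<^sup>2 * \<tau>)"
  using assms by (simp add: heat_symbol_def root_i_def complex_eq_iff abs_mult real_sqrt_mult
      real_sqrt_divide Re_exp Im_exp mult_ac)

lemma integrable_heat_symbol:
  assumes "x > 0"
  shows "integrable lborel (heat_symbol x)"
proof -
  have "integrable lborel (heat_symbol 1)"
    by (rule integrable_norm_cancel[OF integrable_heat_symbol_1]) measurable
  then have "integrable lborel (\<lambda>\<tau>. heat_symbol 1 (0 + x\<^sup>2 * \<tau>))"
    using assms by (intro lborel_integrable_real_affine) auto
  then show ?thesis
    by (simp only: heat_symbol_scale[OF assms, symmetric])
qed

text \<open>The quadratic decay in x is what makes the series of symbols summable in the integral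
  norm.\<close>

lemma integral_norm_heat_symbol:
  assumes "x > 0"
  shows "(LINT \<tau>|lborel. norm (heat_symbol x \<tau>)) = (1 / x\<^sup>2) * (LINT \<tau>|lborel. norm (heat_symbol 1 \<tau>))"
  using assms
  by (subst lborel_integral_real_affine[where c = "x\<^sup>2" and t = 0]) (auto simp: heat_symbol_scale[OF assms])

section \<open>From the sector boundary to the real line\<close>

lemma integral_square_substitution:
  fixes f :: "real \<Rightarrow> complex"
  assumes f: "integrable lborel f"
  shows "(LINT r:{0<..}|lborel. (2 * r) *\<^sub>R f (r\<^sup>2)) = (LINT \<tau>:{0<..}|lborel. f \<tau>)"
proof -
  have [measurable]: "f \<in> borel_measurable borel" using f by auto
  have img: "(\<lambda>r::real. r\<^sup>2) ` {0<..} = {0<..}"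
  proof safe
    fix y :: real assume "y > 0"
    then show "y \<in> power2 ` {0<..}" by (intro image_eqI[of _ _ "sqrt y"]) auto
  qed auto
  have sf: "set_integrable lborel {0<..} f"
    unfolding set_integrable_def using f by (intro integrable_mult_indicator) auto
  \<comment> \<open>The change of variables speaks of Lebesgue measure; for Borel functions
    integrability passes between it and \<open>lborel\<close>.\<close>
  have iff: "set_integrable lebesgue {0<..} g \<longleftrightarrow> set_integrable lborel {0<..} g"
    if "g \<in> borel_measurable borel" for g :: "real \<Rightarrow> complex"
    unfolding set_integrable_def using that by (intro integrable_completion) measurable
  have "f absolutely_integrable_on (\<lambda>r. r\<^sup>2) ` {0<..} \<and>
      integral ((\<lambda>r. r\<^sup>2) ` {0<..}) f = integral {0<..} f"
    using sf by (simp add: img iff)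
  then have "(\<lambda>r. \<bar>2 * r\<bar> *\<^sub>R f (r\<^sup>2)) absolutely_integrable_on {0<..} \<and>
      integral {0<..} (\<lambda>r. \<bar>2 * r\<bar> *\<^sub>R f (r\<^sup>2)) = integral {0<..} f"
    by (subst has_absolute_integral_change_of_variables_real)
      (auto intro!: derivative_eq_intros inj_onI simp: power2_eq_iff)
  then have "set_integrable lborel {0<..} (\<lambda>r. \<bar>2 * r\<bar> *\<^sub>R f (r\<^sup>2))"
      "integral {0<..} (\<lambda>r. \<bar>2 * r\<bar> *\<^sub>R f (r\<^sup>2)) = integral {0<..} f"
    by (auto simp: iff)
  then have "(LINT r:{0<..}|lborel. \<bar>2 * r\<bar> *\<^sub>R f (r\<^sup>2)) = (LINT \<tau>:{0<..}|lborel. f \<tau>)"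
    using sf by (simp only: set_borel_integral_eq_integral)
  moreover have "(LINT r:{0<..}|lborel. \<bar>2 * r\<bar> *\<^sub>R f (r\<^sup>2)) = (LINT r:{0<..}|lborel. (2 * r) *\<^sub>R f (r\<^sup>2))"
    by (intro set_lebesgue_integral_cong) auto
  ultimately show ?thesis by simp
qed

lemma integral_split_sign:
  fixes f :: "real \<Rightarrow> complex"
  assumes f: "integrable lborel f"
  shows "(LINT \<tau>|lborel. f \<tau>) = (LINT \<tau>:{0<..}|lborel. f \<tau>) + (LINT \<tau>:{0<..}|lborel. f (- \<tau>))"
proof -
  have [measurable]: "f \<in> borel_measurable borel" using f by auto
  have si: "integrable lborel (\<lambda>\<tau>. indicator A \<tau> *\<^sub>R f \<tau>)" if "A \<in> sets borel" for A
    using f that by (intro integrable_mult_indicator) auto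
  have "(LINT \<tau>|lborel. f \<tau>) = (LINT \<tau>|lborel. indicator {0<..} \<tau> *\<^sub>R f \<tau> + indicator {..<0} \<tau> *\<^sub>R f \<tau>)"
    by (intro integral_cong_AE) (use AE_lborel_singleton[of 0] in \<open>auto split: split_indicator\<close>)
  also have "\<dots> = (LINT \<tau>|lborel. indicator {0<..} \<tau> *\<^sub>R f \<tau>) + (LINT \<tau>|lborel. indicator {..<0} \<tau> *\<^sub>R f \<tau>)"
    by (intro Bochner_Integration.integral_add si) auto
  also have "(LINT \<tau>|lborel. indicator {..<0} \<tau> *\<^sub>R f \<tau>) = (LINT \<tau>|lborel. indicator {0<..} \<tau> *\<^sub>R f (- \<tau>))"
    by (subst lborel_integral_real_affine[where c = "-1" and t = 0])
      (auto intro!: Bochner_Integration.integral_cong split: split_indicator)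
  finally show ?thesis by (simp add: set_lebesgue_integral_def)
qed

lemma cis_pi_4_square: "cis (pi / 4) * cis (pi / 4) = \<i>"
  by (simp add: cis_mult)

lemma cis_3_pi_4_square: "cis (3 * pi / 4) * cis (3 * pi / 4) = - \<i>"
proof -
  have "cis (3 * pi / 4) * cis (3 * pi / 4) = cis (3 * pi / 4 + 3 * pi / 4)" by (rule cis_mult)
  also have "3 * pi / 4 + 3 * pi / 4 = pi + pi / 2" by simp
  also have "cis \<dots> = cis pi * cis (pi / 2)" by (rule cis_mult [symmetric])
  finally show ?thesis by simp
qed

text \<open>For k = \<open>root_i \<tau>\<close> one has k dk = (\<i> / 2) d\<tau>. The squared
  directions of the rays are \<i> and - \<i>; the second sign cancels the minus sign of the incoming
  ray, so the two rays add up to the whole line.\<close>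

lemma sector_boundary_integral_eq:
  assumes G: "integrable lborel (\<lambda>\<tau>. G (root_i \<tau>))"
  shows "sector_boundary_integral (\<lambda>k. G k * k) = \<i> / 2 * (LINT \<tau>|lborel. G (root_i \<tau>))"
proof -
  have neg: "integrable lborel (\<lambda>\<tau>. G (root_i (- \<tau>)))"
    using lborel_integrable_real_affine[OF G, of "-1" 0] by simp
  note sq = cis_pi_4_square cis_3_pi_4_square
  have "(LINT r:{0<..}|lborel. G (of_real r * cis (pi / 4)) * (of_real r * cis (pi / 4)) * cis (pi / 4)) =
      (LINT r:{0<..}|lborel. \<i> / 2 * ((2 * r) *\<^sub>R G (root_i (r\<^sup>2))))"
  proof (intro set_lebesgue_integral_cong allI impI)
    fix r :: real assume "r \<in> {0<..}"
    then have "G (of_real r * cis (pi / 4)) * (of_real r * cis (pi / 4)) * cis (pi / 4) =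
        G (root_i (r\<^sup>2)) * of_real r * (cis (pi / 4) * cis (pi / 4))"
      by (simp add: root_i_right_ray)
    then show "G (of_real r * cis (pi / 4)) * (of_real r * cis (pi / 4)) * cis (pi / 4) =
        \<i> / 2 * ((2 * r) *\<^sub>R G (root_i (r\<^sup>2)))"
      unfolding sq by (simp add: scaleR_conv_of_real mult_ac)
  qed auto
  moreover have "(LINT r:{0<..}|lborel. G (of_real r * cis (3 * pi / 4)) * (of_real r * cis (3 * pi / 4)) * cis (3 * pi / 4)) =
      (LINT r:{0<..}|lborel. - (\<i> / 2) * ((2 * r) *\<^sub>R G (root_i (- (r\<^sup>2)))))"
  proof (intro set_lebesgue_integral_cong allI impI)
    fix r :: real assume "r \<in> {0<..}"
    then have "G (of_real r * cis (3 * pi / 4)) * (of_real r * cis (3 * pi / 4)) * cis (3 * pi / 4) =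
        G (root_i (- (r\<^sup>2))) * of_real r * (cis (3 * pi / 4) * cis (3 * pi / 4))"
      by (simp add: root_i_left_ray)
    then show "G (of_real r * cis (3 * pi / 4)) * (of_real r * cis (3 * pi / 4)) * cis (3 * pi / 4) =
        - (\<i> / 2) * ((2 * r) *\<^sub>R G (root_i (- (r\<^sup>2))))"
      unfolding sq by (simp add: scaleR_conv_of_real mult_ac)
  qed auto
  ultimately have "sector_boundary_integral (\<lambda>k. G k * k) =
      \<i> / 2 * ((LINT r:{0<..}|lborel. (2 * r) *\<^sub>R G (root_i (r\<^sup>2))) +
        (LINT r:{0<..}|lborel. (2 * r) *\<^sub>R G (root_i (- (r\<^sup>2)))))"
    unfolding sector_boundary_integral_def by (simp only: set_integral_mult_right) (simp add: algebra_simps)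
  then show ?thesis
    by (simp only: integral_square_substitution[OF G] integral_square_substitution[OF neg]
        integral_split_sign[OF G])
qed

section \<open>Causality of the half-line kernel\<close>

text \<open>Up to normalisation this is the Erlang density.\<close>

lemma integrable_power_exp:
  fixes c :: real
  assumes c: "c > 0"
  shows "set_integrable lborel {0<..} (\<lambda>r. r ^ n * exp (- (c * r)))"
proof -
  have "integrable lborel (erlang_density n c)"
    using nn_integral_erlang_ith_moment[OF c, of n 0] c by (intro integrableI_nonneg) auto
  then have "integrable lborel (\<lambda>r. (fact n / c ^ Suc n) * (indicator {0<..} r *\<^sub>R erlang_density n c r))"
    by (intro integrable_mult_right integrable_mult_indicator) auto
  then show ?thesis
    unfolding set_integrable_def
    by (rule Bochner_Integration.integrable_cong[THEN iffD1, rotated -1])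
      (use c in \<open>auto simp: erlang_density_def field_simps split: split_indicator\<close>)
qed

text \<open>The exponential exp (\<i> k x - k^2 s) at the point k = \<omega> r of the ray with
  direction \<omega>.\<close>

definition ray_fun :: "complex \<Rightarrow> real \<Rightarrow> real \<Rightarrow> real \<Rightarrow> complex" where
  "ray_fun \<omega> s x r = exp (\<i> * \<omega> * of_real (r * x) - \<omega>\<^sup>2 * of_real (r\<^sup>2 * s))"

text \<open>The half-line kernel has weight k dk and so involves n = 1. Up to a constant factor, n =
  0 is an antiderivative of that in x, and the causality argument works with it.\<close>

definition ray_moment :: "nat \<Rightarrow> complex \<Rightarrow> real \<Rightarrow> real \<Rightarrow> complex" where
  "ray_moment n \<omega> s x = (LINT r:{0<..}|lborel. of_real r ^ n * ray_fun \<omega> s x r)"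

context
  fixes \<omega> :: complex and s :: real
  assumes \<omega>2: "Re (\<omega>\<^sup>2) = 0" and \<omega>_Im: "Im \<omega> = sqrt 2 / 2"
begin

text \<open>As \<omega>^2 is imaginary, the time factor is unimodular for either sign of s, and the
  imaginary part of \<omega> gives the decay in r. Both boundary rays satisfy the two assumptions on
  \<omega>.\<close>

lemma norm_ray_fun: "norm (ray_fun \<omega> s x r) = exp (- (sqrt 2 / 2 * x * r))"
  using \<omega>2 \<omega>_Im by (simp add: ray_fun_def)

lemma borel_measurable_ray_fun [measurable]: "ray_fun \<omega> s x \<in> borel_measurable borel"
  unfolding ray_fun_def by measurable

lemma set_integrable_ray_moment:
  assumes "x > 0"
  shows "set_integrable lborel {0<..} (\<lambda>r. of_real r ^ n * ray_fun \<omega> s x r)"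
  unfolding set_integrable_def
proof (rule Bochner_Integration.integrable_bound)
  show "integrable lborel (\<lambda>r. indicator {0<..} r *\<^sub>R (r ^ n * exp (- (sqrt 2 / 2 * x * r))))"
    using integrable_power_exp[of "sqrt 2 / 2 * x" n] assms by (simp add: set_integrable_def)
qed (auto simp: norm_mult norm_power norm_ray_fun split: split_indicator)

lemma ray_moment_restrict:
  "ray_moment n \<omega> s x = (LINT r|restrict_space lborel {0<..}. of_real r ^ n * ray_fun \<omega> s x r)"
  by (simp add: ray_moment_def integral_restrict_space set_lebesgue_integral_def)

lemma ray_moment_has_vector_derivative:
  assumes "x > 0"
  shows "(ray_moment 0 \<omega> s has_vector_derivative \<i> * \<omega> * ray_moment 1 \<omega> s x) (at x)"
proof -
  let ?M = "restrict_space lborel {0::real<..}"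
  \<comment> \<open>The decay rate in r degenerates as the space variable tends to 0; staying above
    x / 2 gives one majorant for all points considered.\<close>
  have "((\<lambda>x. LINT r|?M. ray_fun \<omega> s x r) has_vector_derivative
      (LINT r|?M. \<i> * \<omega> * (of_real r * ray_fun \<omega> s x r))) (at x)"
  proof (rule has_vector_derivative_integral_param[where S = "{x / 2<..}" and
        w = "\<lambda>r. norm \<omega> * (r ^ 1 * exp (- (sqrt 2 / 2 * (x / 2) * r)))"])
    fix y assume y: "y \<in> {x / 2<..}"
    then show "integrable ?M (ray_fun \<omega> s y)"
      using set_integrable_ray_moment[of y 0] assms by (simp add: integrable_restrict_space set_integrable_def)
    fix r assume r: "r \<in> space ?M"
    show "((\<lambda>x. ray_fun \<omega> s x r) has_vector_derivative \<i> * \<omega> * (of_real r * ray_fun \<omega> s y r)) (at y)"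
    proof -
      have "((\<lambda>z. exp (\<i> * \<omega> * (of_real r * z) - \<omega>\<^sup>2 * of_real (r\<^sup>2 * s))) has_field_derivative
          \<i> * \<omega> * (of_real r * exp (\<i> * \<omega> * (of_real r * of_real y) - \<omega>\<^sup>2 * of_real (r\<^sup>2 * s)))) (at (of_real y))"
        by (auto intro!: derivative_eq_intros)
      from has_vector_derivative_real_field[OF this] show ?thesis
        by (simp add: ray_fun_def)
    qed
    have "exp (- (sqrt 2 / 2 * y * r)) \<le> exp (- (sqrt 2 / 2 * (x / 2) * r))"
      using y r by (auto simp: space_restrict_space intro!: mult_right_mono)
    then show "norm (\<i> * \<omega> * (of_real r * ray_fun \<omega> s y r)) \<le>
        norm \<omega> * (r ^ 1 * exp (- (sqrt 2 / 2 * (x / 2) * r)))"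
      using r by (auto simp: norm_mult norm_ray_fun space_restrict_space intro!: mult_left_mono)
  next
    show "integrable ?M (\<lambda>r. norm \<omega> * (r ^ 1 * exp (- (sqrt 2 / 2 * (x / 2) * r))))"
      using integrable_power_exp[of "sqrt 2 / 2 * (x / 2)" 1] assms
      by (intro integrable_mult_right) (simp add: integrable_restrict_space set_integrable_def)
    show "(\<lambda>r. \<i> * \<omega> * (of_real r * ray_fun \<omega> s x r)) \<in> borel_measurable ?M"
      by (intro measurable_restrict_space1) measurable
  qed (use assms in auto)
  then show ?thesis
    by (simp add: ray_moment_restrict[abs_def])
qed

text \<open>The integral of the \<open>r\<close>-derivative of \<open>ray_fun\<close> over the ray.\<close>

lemma ray_moment_by_parts:
  assumes x: "x > 0"
  shows "\<i> * \<omega> * of_real x * ray_moment 0 \<omega> s x - 2 * \<omega>\<^sup>2 * of_real s * ray_moment 1 \<omega> s x = - 1"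
proof -
  define f where "f r = \<i> * \<omega> * of_real x * (of_real r ^ 0 * ray_fun \<omega> s x r) -
    2 * \<omega>\<^sup>2 * of_real s * (of_real r ^ 1 * ray_fun \<omega> s x r)" for r
  note int = set_integrable_ray_moment[OF x]
  have "(LBINT r=0..\<infinity>. f r) = 0 - 1"
  proof (rule interval_integral_FTC_integrable[where F = "ray_fun \<omega> s x"])
    show "(ray_fun \<omega> s x has_vector_derivative f r) (at r)" for r
    proof -
      let ?e = "\<lambda>z. exp (\<i> * \<omega> * (z * of_real x) - \<omega>\<^sup>2 * (z\<^sup>2 * of_real s))"
      have "(?e has_field_derivative (\<i> * \<omega> * of_real x - 2 * \<omega>\<^sup>2 * of_real s * of_real r) * ?e (of_real r)) (at (of_real r))"
        by (auto intro!: derivative_eq_intros simp: algebra_simps)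
      from has_vector_derivative_real_field[OF this] show ?thesis
        by (simp add: ray_fun_def[abs_def] f_def left_diff_distrib mult.assoc)
    qed
    show "isCont f r" for r
      unfolding ray_fun_def f_def by (intro continuous_intros)
    show "set_integrable lborel (einterval 0 \<infinity>) f"
      unfolding f_def zero_ereal_def einterval_eq
      by (intro set_integral_diff set_integrable_mult_right int)
    have "((\<lambda>r. norm (ray_fun \<omega> s x r)) \<longlongrightarrow> 0) at_top"
      unfolding norm_ray_fun using x by real_asymp
    then show "((ray_fun \<omega> s x \<circ> real_of_ereal) \<longlongrightarrow> 0) (at_left \<infinity>)"
      by (simp add: ereal_tendsto_simps tendsto_norm_zero_iff)
    have "isCont (ray_fun \<omega> s x) 0"
      unfolding ray_fun_def by (intro continuous_intros)
    then have "(ray_fun \<omega> s x \<longlongrightarrow> ray_fun \<omega> s x 0) (at_right 0)"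
      unfolding isCont_def by (rule filterlim_at_split[THEN iffD1, THEN conjunct2])
    then show "((ray_fun \<omega> s x \<circ> real_of_ereal) \<longlongrightarrow> 1) (at_right 0)"
      by (simp add: zero_ereal_def ereal_tendsto_simps) (simp add: ray_fun_def)
  qed auto
  then have "(LINT r:{0<..}|lborel. f r) = - 1"
    by (simp add: interval_lebesgue_integral_0_infty)
  moreover have "(LINT r:{0<..}|lborel. f r) =
      \<i> * \<omega> * of_real x * ray_moment 0 \<omega> s x - 2 * \<omega>\<^sup>2 * of_real s * ray_moment 1 \<omega> s x"
    unfolding f_def
    by (simp only: set_integral_diff(2)[OF set_integrable_mult_right set_integrable_mult_right, OF int int]
        set_integral_mult_right ray_moment_def)
  ultimately show ?thesis by simp
qed

text \<open>The bound is uniform in x; it limits the growth of the ray integrals as x tends to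
  infinity.\<close>

lemma norm_ray_moment_0_le:
  assumes "x \<ge> 1"
  shows "norm (ray_moment 0 \<omega> s x) \<le> (LINT r:{0<..}|lborel. exp (- (sqrt 2 / 2 * r)))"
proof -
  have "norm (ray_moment 0 \<omega> s x) \<le> (LINT r:{0<..}|lborel. norm (ray_fun \<omega> s x r))"
    using set_integral_norm_bound[OF set_integrable_ray_moment[of x 0]] assms by (simp add: ray_moment_def)
  also have "\<dots> \<le> (LINT r:{0<..}|lborel. exp (- (sqrt 2 / 2 * r)))"
  proof (rule set_integral_mono)
    show "set_integrable lborel {0<..} (\<lambda>r. norm (ray_fun \<omega> s x r))"
      using set_integrable_norm[OF set_integrable_ray_moment[of x 0]] assms by simp
    show "set_integrable lborel {0<..} (\<lambda>r. exp (- (sqrt 2 / 2 * r)))"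
      using integrable_power_exp[of "sqrt 2 / 2" 0] by simp
    show "norm (ray_fun \<omega> s x r) \<le> exp (- (sqrt 2 / 2 * r))" if "r \<in> {0<..}" for r
      using that assms by (simp add: norm_ray_fun mult_right_mono)
  qed
  finally show ?thesis .
qed

end

text \<open>The passage to the real line read backwards: on the ray k = \<omega> r the measure k dk
  is \<omega>^2 r dr.\<close>

lemma inv_fourier_heat_symbol_eq:
  assumes x: "x > 0"
  shows "inv_fourier (heat_symbol x) s = 1 / (\<i> * of_real pi) *
    ((cis (pi / 4))\<^sup>2 * ray_moment 1 (cis (pi / 4)) s x - (cis (3 * pi / 4))\<^sup>2 * ray_moment 1 (cis (3 * pi / 4)) s x)"
proof -
  define G where "G k = exp (\<i> * k * of_real x - k\<^sup>2 * of_real s)" for k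
  have G: "G (root_i \<tau>) = cis (- (\<tau> * s)) * heat_symbol x \<tau>" for \<tau>
    by (simp add: G_def heat_symbol_def root_i_power2 cis_conv_exp mult_ac flip: exp_add)
  have "integrable lborel (\<lambda>\<tau>. G (root_i \<tau>))"
    unfolding G by (intro integrable_cis_mult integrable_heat_symbol x) measurable
  from sector_boundary_integral_eq[OF this]
  have "inv_fourier (heat_symbol x) s = 1 / (\<i> * of_real pi) * sector_boundary_integral (\<lambda>k. G k * k)"
    unfolding G inv_fourier_def by (simp add: field_simps)
  also have "sector_boundary_integral (\<lambda>k. G k * k) =
      (LINT r:{0<..}|lborel. (cis (pi / 4))\<^sup>2 * (of_real r ^ 1 * ray_fun (cis (pi / 4)) s x r)) -
      (LINT r:{0<..}|lborel. (cis (3 * pi / 4))\<^sup>2 * (of_real r ^ 1 * ray_fun (cis (3 * pi / 4)) s x r))"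
    by (simp add: sector_boundary_integral_def G_def ray_fun_def power2_eq_square mult_ac)
  finally show ?thesis
    by (simp only: set_integral_mult_right ray_moment_def)
qed

text \<open>As a function of \<open>x\<close>, the difference \<open>\<Psi>\<close> of the two ray integrals is a multiple of
  \<open>exp (- x\<^sup>2 / (4 * s))\<close>; for negative \<open>s\<close> this grows while \<open>\<Psi>\<close> stays bounded.\<close>

lemma inv_fourier_heat_symbol_causal:
  assumes x: "x > 0" and s: "s \<le> 0"
  shows "inv_fourier (heat_symbol x) s = 0"
proof -
  have neg: "inv_fourier (heat_symbol x) s = 0" if s: "s < 0" for s
  proof -
    define \<alpha> \<beta> where "\<alpha> = cis (pi / 4)" and "\<beta> = cis (3 * pi / 4)"
    have "3 * pi / 4 = pi - pi / 4" by simp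
    then have "Im \<beta> = sqrt 2 / 2"
      unfolding \<beta>_def cis.sel by (simp only: sin_pi_minus sin_45)
    moreover have "Re (\<alpha>\<^sup>2) = 0" "Re (\<beta>\<^sup>2) = 0"
      unfolding \<alpha>_def \<beta>_def power2_eq_square cis_pi_4_square cis_3_pi_4_square by simp_all
    moreover have "Im \<alpha> = sqrt 2 / 2" by (simp add: \<alpha>_def sin_45)
    ultimately have \<alpha>: "Re (\<alpha>\<^sup>2) = 0" "Im \<alpha> = sqrt 2 / 2" and \<beta>: "Re (\<beta>\<^sup>2) = 0" "Im \<beta> = sqrt 2 / 2"
      by auto
    \<comment> \<open>The kernel is a constant multiple of \<open>\<Psi>1\<close>, and \<i> times
      \<open>\<Psi>1\<close> is the derivative of \<open>\<Psi>\<close>. By \<open>parts\<close> it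
      is enough to show \<Psi> x = 0.\<close>
    define \<Psi> where "\<Psi> y = \<alpha> * ray_moment 0 \<alpha> s y - \<beta> * ray_moment 0 \<beta> s y" for y
    define \<Psi>1 where "\<Psi>1 y = \<alpha>\<^sup>2 * ray_moment 1 \<alpha> s y - \<beta>\<^sup>2 * ray_moment 1 \<beta> s y" for y
    \<comment> \<open>The boundary term - 1 of the integration by parts is the same for both
      directions and cancels in the difference.\<close>
    have parts: "\<i> * of_real y * \<Psi> y = 2 * of_real s * \<Psi>1 y" if "y > 0" for y
    proof -
      have "\<i> * \<alpha> * of_real y * ray_moment 0 \<alpha> s y - 2 * \<alpha>\<^sup>2 * of_real s * ray_moment 1 \<alpha> s y =
          \<i> * \<beta> * of_real y * ray_moment 0 \<beta> s y - 2 * \<beta>\<^sup>2 * of_real s * ray_moment 1 \<beta> s y"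
        by (simp only: ray_moment_by_parts[OF \<alpha> that] ray_moment_by_parts[OF \<beta> that])
      then show ?thesis
        unfolding \<Psi>_def \<Psi>1_def by algebra
    qed
    have \<Psi>1: "\<i> * \<Psi>1 y = - of_real (y / (2 * s)) * \<Psi> y" if "y > 0" for y
    proof -
      have "\<Psi>1 y = \<i> * of_real y * \<Psi> y / (2 * of_real s)"
        using parts[OF that] s by (simp add: field_simps)
      then show ?thesis by (simp add: field_simps)
    qed
    have \<Psi>_deriv: "(\<Psi> has_vector_derivative \<i> * \<Psi>1 y) (at y)" if "y > 0" for y
    proof -
      have "(\<Psi> has_vector_derivative \<alpha> * (\<i> * \<alpha> * ray_moment 1 \<alpha> s y) - \<beta> * (\<i> * \<beta> * ray_moment 1 \<beta> s y)) (at y)"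
        unfolding \<Psi>_def
        by (intro has_vector_derivative_diff has_vector_derivative_mult_right
            ray_moment_has_vector_derivative \<alpha> \<beta> that)
      then show ?thesis
        by (simp add: \<Psi>1_def power2_eq_square algebra_simps)
    qed
    \<comment> \<open>The two relations give the equation \<Psi>' = - (y / (2 s)) \<Psi>, and the
      exponential is its integrating factor, so \<open>Q\<close> is constant.\<close>
    define Q where "Q y = \<Psi> y * of_real (exp (y\<^sup>2 / (4 * s)))" for y
    have "(Q has_vector_derivative 0) (at y)" if "y > 0" for y
    proof -
      have "((\<lambda>y. complex_of_real (exp (y\<^sup>2 / (4 * s)))) has_vector_derivative
          of_real (y / (2 * s) * exp (y\<^sup>2 / (4 * s)))) (at y)"
        by (intro has_vector_derivative_of_real)
          (use s in \<open>auto intro!: derivative_eq_intros simp: field_simps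
            simp flip: has_real_derivative_iff_has_vector_derivative\<close>)
      from has_vector_derivative_mult[OF \<Psi>_deriv[OF that] this]
      show ?thesis
        unfolding Q_def \<Psi>1[OF that] by (simp add: algebra_simps)
    qed
    then have "\<exists>c. \<forall>y\<in>{0<..}. Q y = c"
      by (intro has_derivative_zero_constant)
        (auto simp: has_vector_derivative_def intro: has_derivative_at_withinI)
    then obtain c where c: "\<And>y. y > 0 \<Longrightarrow> Q y = c" by auto
    define B where "B = (LINT r:{0<..}|lborel. exp (- (sqrt 2 / 2 * r)))"
    have le: "norm c \<le> (norm \<alpha> * B + norm \<beta> * B) * exp (y\<^sup>2 / (4 * s))" if "y \<ge> 1" for y
    proof -
      have "norm (\<Psi> y) \<le> norm \<alpha> * norm (ray_moment 0 \<alpha> s y) + norm \<beta> * norm (ray_moment 0 \<beta> s y)"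
        unfolding \<Psi>_def by (rule order_trans[OF norm_triangle_ineq4]) (simp add: norm_mult)
      also have "\<dots> \<le> norm \<alpha> * B + norm \<beta> * B"
        unfolding B_def using norm_ray_moment_0_le[OF \<alpha> that] norm_ray_moment_0_le[OF \<beta> that]
        by (intro add_mono mult_left_mono) auto
      finally show ?thesis
        using c[of y] that by (auto simp: Q_def norm_mult intro!: mult_right_mono)
    qed
    have "((\<lambda>y. (norm \<alpha> * B + norm \<beta> * B) * exp (y\<^sup>2 / (4 * s))) \<longlongrightarrow> 0) at_top"
      using s by real_asymp
    then have "norm c \<le> 0"
      by (rule tendsto_lowerbound) (auto intro!: eventually_at_top_linorderI[of 1] le)
    then have "\<Psi> x = 0"
      using c[OF x] by (simp add: Q_def)
    then have "\<Psi>1 x = 0"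
      using parts[OF x] s by simp
    then show ?thesis
      unfolding inv_fourier_heat_symbol_eq[OF x] by (simp add: \<Psi>1_def \<alpha>_def \<beta>_def)
  qed
  \<comment> \<open>The case s = 0 is the limit of negative times, by continuity of the
    kernel.\<close>
  have "closed {s. inv_fourier (heat_symbol x) s = 0}"
    using continuous_inv_fourier[OF integrable_heat_symbol[OF x]]
    by (intro closed_Collect_eq) auto
  then have "closure {..<0} \<subseteq> {s. inv_fourier (heat_symbol x) s = 0}"
    using neg by (intro closure_minimal) auto
  then show ?thesis using s by auto
qed

section \<open>The geometric series of symbols\<close>

lemma norm_heat_symbol_less_1:
  assumes "x > 0" "\<tau> \<noteq> 0"
  shows "norm (heat_symbol x \<tau>) < 1"
  using assms by (simp add: norm_heat_symbol)

lemma norm_heat_symbol_le_1: "x \<ge> 0 \<Longrightarrow> norm (heat_symbol x \<tau>) \<le> 1"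
  by (simp add: norm_heat_symbol)

text \<open>The sum over the method-of-images distances y + 2 l n in closed form. At \<tau> = 0 the
  denominator is 0 and so is the value, which is why the identities below hold only almost
  everywhere.\<close>

definition resolvent_symbol :: "real \<Rightarrow> real \<Rightarrow> real \<Rightarrow> complex" where
  "resolvent_symbol l y \<tau> = heat_symbol y \<tau> / (1 - heat_symbol (2 * l) \<tau>)"

lemma borel_measurable_resolvent_symbol [measurable]: "resolvent_symbol l y \<in> borel_measurable borel"
  unfolding resolvent_symbol_def by measurable

lemma heat_symbol_mult_resolvent_symbol:
  "heat_symbol x \<tau> * resolvent_symbol l y \<tau> = resolvent_symbol l (x + y) \<tau>"
  by (simp add: resolvent_symbol_def heat_symbol_mult)

lemma resolvent_symbol_eq:
  assumes "l > 0" "\<tau> \<noteq> 0"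
  shows "resolvent_symbol l y \<tau> = heat_symbol y \<tau> + resolvent_symbol l (2 * l + y) \<tau>"
proof -
  have "heat_symbol (2 * l) \<tau> \<noteq> 1"
    using norm_heat_symbol_less_1[of "2 * l" \<tau>] assms by auto
  then show ?thesis
    by (simp add: resolvent_symbol_def field_simps heat_symbol_mult)
qed

lemma resolvent_symbol_sums:
  assumes "l > 0" "\<tau> \<noteq> 0"
  shows "(\<lambda>n. heat_symbol (y + 2 * l * real n) \<tau>) sums resolvent_symbol l y \<tau>"
proof -
  have "heat_symbol (y + 2 * l * real n) \<tau> = heat_symbol y \<tau> * heat_symbol (2 * l) \<tau> ^ n" for n
    by (simp add: heat_symbol_def algebra_simps flip: exp_of_nat_mult exp_add)
  then show ?thesis
    using sums_mult[OF geometric_sums[OF norm_heat_symbol_less_1[of "2 * l" \<tau>]], of "heat_symbol y \<tau>"] assms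
    by (simp add: resolvent_symbol_def)
qed

context
  fixes l y :: real
  assumes l: "l > 0" and y: "y > 0"
begin

lemma pos_shift: "y + 2 * l * real n > 0"
  using l y by (simp add: add_pos_nonneg)

lemma AE_resolvent_symbol_suminf:
  "AE \<tau> in lborel. resolvent_symbol l y \<tau> = (\<Sum>n. heat_symbol (y + 2 * l * real n) \<tau>)"
  using AE_lborel_singleton[of 0] by eventually_elim (use l resolvent_symbol_sums in \<open>auto simp: sums_iff\<close>)

lemma summable_norm_heat_symbol:
  assumes "\<tau> \<noteq> 0"
  shows "summable (\<lambda>n. norm (heat_symbol (y + 2 * l * real n) \<tau>))"
proof -
  have "norm (heat_symbol (y + 2 * l * real n) \<tau>) = norm (heat_symbol y \<tau>) * norm (heat_symbol (2 * l) \<tau>) ^ n" for n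
    by (simp add: norm_heat_symbol algebra_simps flip: exp_of_nat_mult exp_add)
  then show ?thesis
    using norm_heat_symbol_less_1[of "2 * l" \<tau>] l assms by (auto intro!: summable_mult summable_geometric)
qed

lemma summable_integral_norm_heat_symbol:
  "summable (\<lambda>n. LINT \<tau>|lborel. norm (heat_symbol (y + 2 * l * real n) \<tau>))"
proof -
  define C where "C = (LINT \<tau>|lborel. norm (heat_symbol 1 \<tau>))"
  have C: "C \<ge> 0" by (simp add: C_def)
  \<comment> \<open>With this \<open>m\<close> the n-th distance is at least m (n + 1), and the
    series is dominated by a multiple of the sum of 1 / (n + 1)^2.\<close>
  define m where "m = min y (2 * l)"
  have m: "m > 0" using l y by (simp add: m_def)
  have "summable (\<lambda>n. C / m\<^sup>2 * inverse (real (Suc n) ^ 2))"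
    by (intro summable_mult) (use inverse_power_summable[of 2] in \<open>simp only: summable_Suc_iff[of "\<lambda>n. inverse (real n ^ 2)"], auto\<close>)
  then show ?thesis
  proof (rule summable_comparison_test'[where N = 0])
    fix n :: nat
    have "m * real (Suc n) \<le> y + 2 * l * real n"
      using l y by (simp add: m_def distrib_left add_mono mult_right_mono)
    then have "(m * real (Suc n))\<^sup>2 \<le> (y + 2 * l * real n)\<^sup>2"
      using m by (intro power_mono) auto
    then have "C / (y + 2 * l * real n)\<^sup>2 \<le> C / (m * real (Suc n))\<^sup>2"
      using C m pos_shift[of n] by (intro divide_left_mono) auto
    also have "\<dots> = C / m\<^sup>2 * inverse (real (Suc n) ^ 2)"
      by (simp only: power_mult_distrib divide_inverse inverse_mult_distrib mult.assoc)
    finally have "C / (y + 2 * l * real n)\<^sup>2 \<le> C / m\<^sup>2 * inverse (real (Suc n) ^ 2)" .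
    then show "norm (LINT \<tau>|lborel. norm (heat_symbol (y + 2 * l * real n) \<tau>)) \<le>
        C / m\<^sup>2 * inverse (real (Suc n) ^ 2)"
      using C by (simp add: integral_norm_heat_symbol[OF pos_shift] flip: C_def)
  qed
qed

text \<open>Summing the integral norms of the terms replaces a local analysis of the singularity at
  \<tau> = 0.\<close>

lemma integrable_resolvent_symbol: "integrable lborel (resolvent_symbol l y)"
proof -
  have "integrable lborel (\<lambda>\<tau>. \<Sum>n. heat_symbol (y + 2 * l * real n) \<tau>)"
  proof (rule integrable_suminf)
    show "integrable lborel (heat_symbol (y + 2 * l * real n))" for n
      by (rule integrable_heat_symbol[OF pos_shift])
    show "AE \<tau> in lborel. summable (\<lambda>n. norm (heat_symbol (y + 2 * l * real n) \<tau>))"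
      using AE_lborel_singleton[of 0] by eventually_elim (rule summable_norm_heat_symbol)
  qed (rule summable_integral_norm_heat_symbol)
  then show ?thesis
    by (subst integrable_cong_AE[OF _ _ AE_resolvent_symbol_suminf]) auto
qed

lemma inv_fourier_resolvent_symbol_causal:
  assumes s: "s \<le> 0"
  shows "inv_fourier (resolvent_symbol l y) s = 0"
proof -
  have "(LINT \<tau>|lborel. cis (- (\<tau> * s)) * heat_symbol (y + 2 * l * real n) \<tau>) = 0" for n
    using inv_fourier_heat_symbol_causal[OF pos_shift s, of n] by (simp add: inv_fourier_def)
  moreover have "(LINT \<tau>|lborel. (\<Sum>n. cis (- (\<tau> * s)) * heat_symbol (y + 2 * l * real n) \<tau>)) =
      (\<Sum>n. LINT \<tau>|lborel. cis (- (\<tau> * s)) * heat_symbol (y + 2 * l * real n) \<tau>)"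
  proof (rule integral_suminf)
    show "integrable lborel (\<lambda>\<tau>. cis (- (\<tau> * s)) * heat_symbol (y + 2 * l * real n) \<tau>)" for n
      by (intro integrable_cis_mult integrable_heat_symbol pos_shift) measurable
    show "AE \<tau> in lborel. summable (\<lambda>n. norm (cis (- (\<tau> * s)) * heat_symbol (y + 2 * l * real n) \<tau>))"
      using AE_lborel_singleton[of 0] by eventually_elim (simp add: norm_mult summable_norm_heat_symbol)
    show "summable (\<lambda>n. LINT \<tau>|lborel. norm (cis (- (\<tau> * s)) * heat_symbol (y + 2 * l * real n) \<tau>))"
      using summable_integral_norm_heat_symbol by (simp add: norm_mult)
  qed
  moreover have "(LINT \<tau>|lborel. cis (- (\<tau> * s)) * resolvent_symbol l y \<tau>) =
      (LINT \<tau>|lborel. (\<Sum>n. cis (- (\<tau> * s)) * heat_symbol (y + 2 * l * real n) \<tau>))"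
  proof (rule integral_cong_AE)
    show "AE \<tau> in lborel. cis (- (\<tau> * s)) * resolvent_symbol l y \<tau> =
        (\<Sum>n. cis (- (\<tau> * s)) * heat_symbol (y + 2 * l * real n) \<tau>)"
      using AE_lborel_singleton[of 0]
      by eventually_elim (use resolvent_symbol_sums[OF l, THEN sums_mult] in \<open>simp add: sums_iff\<close>)
  qed auto
  ultimately show ?thesis
    by (simp add: inv_fourier_def)
qed

end

text \<open>With u = \<open>x * sqrt (\<bar>\<tau>\<bar> / 2)\<close>, |\<tau>|^j is (2 / x^2)^j
  u^(2 j), and (u / (2 j))^(2 j) \<le> exp u gives the constant. The case j = 0 is separate because
  of the division by j.\<close>

lemma norm_power_heat_symbol_le:
  assumes x: "x > 0"
  shows "norm (of_real \<tau> ^ j * heat_symbol x \<tau>) \<le> (2 / x\<^sup>2) ^ j * (2 * real j) ^ (2 * j)"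
proof (cases "j = 0")
  case False
  define u where "u = x * sqrt (\<bar>\<tau>\<bar> / 2)"
  have u: "u \<ge> 0" "\<bar>\<tau>\<bar> = (2 / x\<^sup>2) * u\<^sup>2"
    using x by (simp_all add: u_def power_mult_distrib)
  have nh: "norm (heat_symbol x \<tau>) = exp (- u)"
    by (simp add: norm_heat_symbol u_def)
  have "(u / (2 * real j)) ^ (2 * j) \<le> (1 + u / real (2 * j)) ^ (2 * j)"
    using u(1) by (intro power_mono) auto
  also have "\<dots> \<le> exp u"
    using u(1) False by (intro exp_ge_one_plus_x_over_n_power_n) auto
  finally have "u ^ (2 * j) \<le> (2 * real j) ^ (2 * j) * exp u"
    using False by (simp add: power_divide field_simps)
  then have "u ^ (2 * j) * exp (- u) \<le> (2 * real j) ^ (2 * j)"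
    by (simp add: exp_minus field_simps)
  then have "(2 / x\<^sup>2) ^ j * (u ^ (2 * j) * exp (- u)) \<le> (2 / x\<^sup>2) ^ j * (2 * real j) ^ (2 * j)"
    by (intro mult_left_mono) auto
  moreover have "norm (of_real \<tau> ^ j * heat_symbol x \<tau>) = (2 / x\<^sup>2) ^ j * (u ^ (2 * j) * exp (- u))"
    unfolding norm_mult norm_power nh norm_of_real u(2) power_mult_distrib[of "2 / x\<^sup>2"] power_mult
    by (simp only: mult.assoc)
  ultimately show ?thesis by simp
qed (use norm_heat_symbol_le_1 x in auto)

text \<open>Half of y is spent on absorbing the power of \<tau> into a bounded factor; the other
  half keeps the resolvent symbol integrable.\<close>

lemma integrable_power_resolvent_symbol:
  assumes l: "l > 0" and y: "y > 0"
  shows "integrable lborel (\<lambda>\<tau>. of_real \<tau> ^ j * resolvent_symbol l y \<tau>)"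
proof -
  have "integrable lborel (\<lambda>\<tau>. (of_real \<tau> ^ j * heat_symbol (y / 2) \<tau>) * resolvent_symbol l (y / 2) \<tau>)"
    using l y by (intro integrable_bounded_mult[OF _ _ norm_power_heat_symbol_le] integrable_resolvent_symbol) auto
  then show ?thesis
    by (simp add: mult.assoc heat_symbol_mult_resolvent_symbol)
qed

section \<open>Smooth perturbations in Sobolev spaces\<close>

lemma finite_measure_lebesgue_on_Ioo: "finite_measure (lebesgue_on {a<..<b::real})"
  using lmeasurable_box[of a b] by (intro finite_measure_lebesgue_on) simp

lemma L2_space_integrable:
  assumes "f \<in> L2_space T"
  shows "integrable (lebesgue_on {0<..<T}) f"
proof -
  interpret finite_measure "lebesgue_on {0<..<T}" by (rule finite_measure_lebesgue_on_Ioo)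
  show ?thesis
  proof (rule Bochner_Integration.integrable_bound)
    show "integrable (lebesgue_on {0<..<T}) (\<lambda>t. 1 + (norm (f t))\<^sup>2)"
      using assms by (auto simp: L2_space_def)
    show "f \<in> borel_measurable (lebesgue_on {0<..<T})"
      using assms by (auto simp: L2_space_def)
    have "norm (f t) \<le> 1 + (norm (f t))\<^sup>2" for t
      using sum_squares_bound[of "norm (f t)" 1] norm_ge_zero[of "f t"] unfolding power_one by linarith
    then show "AE t in lebesgue_on {0<..<T}. norm (f t) \<le> norm (1 + (norm (f t))\<^sup>2)"
      by (intro AE_I2) (simp add: add_nonneg_nonneg)
  qed
qed

lemma norm_add_power2_le:
  fixes a b :: "'a::real_normed_vector"
  shows "(norm (a + b))\<^sup>2 \<le> 2 * (norm a)\<^sup>2 + 2 * (norm b)\<^sup>2"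
proof -
  have "(norm (a + b))\<^sup>2 \<le> (norm a + norm b)\<^sup>2"
    by (intro power_mono norm_triangle_ineq) auto
  also have "\<dots> \<le> 2 * (norm a)\<^sup>2 + 2 * (norm b)\<^sup>2"
    using sum_squares_bound[of "norm a" "norm b"] by (simp add: power2_sum)
  finally show ?thesis .
qed

lemma L2_space_add:
  assumes f: "f \<in> L2_space T" and g: "g \<in> L2_space T"
  shows "(\<lambda>t. f t + g t) \<in> L2_space T"
proof -
  have [measurable]: "f \<in> borel_measurable (lebesgue_on {0<..<T})" "g \<in> borel_measurable (lebesgue_on {0<..<T})"
    using f g by (auto simp: L2_space_def)
  have "integrable (lebesgue_on {0<..<T}) (\<lambda>t. (norm (f t + g t))\<^sup>2)"
  proof (rule Bochner_Integration.integrable_bound)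
    show "integrable (lebesgue_on {0<..<T}) (\<lambda>t. 2 * (norm (f t))\<^sup>2 + 2 * (norm (g t))\<^sup>2)"
      using f g by (auto simp: L2_space_def)
  qed (auto simp: norm_add_power2_le)
  then show ?thesis by (simp add: L2_space_def)
qed

lemma borel_measurable_lebesgue_on_continuous:
  assumes "continuous_on UNIV f" "S \<in> sets lebesgue"
  shows "f \<in> borel_measurable (lebesgue_on S)"
  using assms by (intro continuous_imp_measurable_on_sets_lebesgue) (auto intro: continuous_on_subset)

lemma continuous_bounded_Icc:
  fixes f :: "real \<Rightarrow> 'a::real_normed_vector"
  assumes "continuous_on UNIV f"
  shows "\<exists>B. \<forall>t\<in>{0..T}. norm (f t) \<le> B"
proof -
  have "compact (f ` {0..T})"
    using assms by (intro compact_continuous_image) (auto intro: continuous_on_subset)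
  then have "bounded (f ` {0..T})" by (rule compact_imp_bounded)
  then show ?thesis by (auto simp: bounded_iff)
qed

lemma continuous_L2_space:
  assumes f: "continuous_on UNIV f"
  shows "f \<in> L2_space T"
proof -
  interpret finite_measure "lebesgue_on {0<..<T}" by (rule finite_measure_lebesgue_on_Ioo)
  have [measurable]: "f \<in> borel_measurable (lebesgue_on {0<..<T})"
    by (rule borel_measurable_lebesgue_on_continuous[OF f]) auto
  obtain B where B: "\<And>t. t \<in> {0..T} \<Longrightarrow> norm (f t) \<le> B"
    using continuous_bounded_Icc[OF f] by blast
  have "integrable (lebesgue_on {0<..<T}) (\<lambda>t. (norm (f t))\<^sup>2)"
    by (rule integrable_const_bound[where B = "B\<^sup>2"])
      (use B in \<open>auto intro!: AE_I2 power_mono simp: space_restrict_space\<close>)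
  then show ?thesis by (simp add: L2_space_def)
qed

section \<open>Integration by parts against test functions\<close>

context
  fixes T :: real and \<phi> :: "real \<Rightarrow> real"
  assumes \<phi>: "test_function T \<phi>"
begin

lemma test_function_deriv: "((deriv ^^ n) \<phi> has_real_derivative (deriv ^^ Suc n) \<phi> x) (at x)"
  using \<phi> by (auto simp: test_function_def field_differentiable_derivI)

lemma test_function_continuous: "continuous_on UNIV ((deriv ^^ n) \<phi>)"
  by (intro continuous_at_imp_continuous_on ballI DERIV_isCont[OF test_function_deriv])

text \<open>The induction runs over the complement of the support \<open>K\<close>, which is open,
  so that vanishing passes to derivatives; the complement of the interval itself is not
  open.\<close>

lemma test_function_zero_outside:
  assumes "x \<notin> {0<..<T}"
  shows "(deriv ^^ n) \<phi> x = 0"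
proof -
  obtain K where K: "compact K" "K \<subseteq> {0<..<T}" "\<And>x. x \<notin> K \<Longrightarrow> \<phi> x = 0"
    using \<phi> by (auto simp: test_function_def)
  have "\<forall>x. x \<notin> K \<longrightarrow> (deriv ^^ n) \<phi> x = 0"
  proof (induction n)
    case (Suc n)
    show ?case
    proof (intro allI impI)
      fix x assume x: "x \<notin> K"
      have "open (- K)" using K(1) compact_imp_closed by auto
      have "((deriv ^^ n) \<phi> has_real_derivative 0) (at x)"
      proof (rule has_field_derivative_transform_within_open[OF DERIV_const \<open>open (- K)\<close>])
        show "0 = (deriv ^^ n) \<phi> y" if "y \<in> - K" for y
          using Suc that by simp
      qed (use x in simp)
      then show "(deriv ^^ Suc n) \<phi> x = 0"
        by (rule DERIV_unique[OF test_function_deriv])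
    qed
  qed (use K in auto)
  then show ?thesis using assms K(2) by blast
qed

lemma integrable_test_function_mult:
  assumes f: "integrable (lebesgue_on {0<..<T}) f"
  shows "integrable (lebesgue_on {0<..<T}) (\<lambda>t. complex_of_real ((deriv ^^ n) \<phi> t) * f t)"
proof -
  obtain B where B: "\<And>t. t \<in> {0..T} \<Longrightarrow> norm ((deriv ^^ n) \<phi> t) \<le> B"
    using continuous_bounded_Icc[OF test_function_continuous[of n]] by blast
  have [measurable]: "(deriv ^^ n) \<phi> \<in> borel_measurable (lebesgue_on {0<..<T})"
    by (rule borel_measurable_lebesgue_on_continuous[OF test_function_continuous]) auto
  show ?thesis
    using B by (intro integrable_bounded_mult[OF f, where C = B]) (auto simp: space_restrict_space)
qed

lemma test_function_by_parts:
  assumes T: "0 < T"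
    and f: "\<And>t. (f has_vector_derivative f' t) (at t)"
    and f': "continuous_on UNIV f'"
  shows "(LINT t|lebesgue_on {0<..<T}. complex_of_real ((deriv ^^ Suc n) \<phi> t) * f t) =
    - (LINT t|lebesgue_on {0<..<T}. complex_of_real ((deriv ^^ n) \<phi> t) * f' t)"
proof -
  have contf: "continuous_on UNIV f"
    using f by (intro continuous_at_imp_continuous_on ballI) (rule has_vector_derivative_continuous)
  have int: "integrable (lebesgue_on {0<..<T}) (\<lambda>t. complex_of_real ((deriv ^^ k) \<phi> t) * h t)"
    if "continuous_on UNIV h" for k h
    by (intro integrable_test_function_mult L2_space_integrable continuous_L2_space that)
  define h where "h t = complex_of_real ((deriv ^^ n) \<phi> t) * f' t + complex_of_real ((deriv ^^ Suc n) \<phi> t) * f t" for t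
  have "(h has_integral (complex_of_real ((deriv ^^ n) \<phi> T) * f T - complex_of_real ((deriv ^^ n) \<phi> 0) * f 0)) {0..T}"
  proof (rule fundamental_theorem_of_calculus)
    fix t
    have "((\<lambda>t. complex_of_real ((deriv ^^ n) \<phi> t)) has_vector_derivative complex_of_real ((deriv ^^ Suc n) \<phi> t)) (at t)"
      by (intro has_vector_derivative_of_real) (simp add: test_function_deriv flip: has_real_derivative_iff_has_vector_derivative del: funpow.simps)
    from has_vector_derivative_mult[OF this f]
    show "((\<lambda>t. complex_of_real ((deriv ^^ n) \<phi> t) * f t) has_vector_derivative h t) (at t within {0..T})"
      unfolding h_def by (rule has_vector_derivative_at_within)
  qed (use T in auto)
  then have "(h has_integral 0) {0<..<T}"
    using T by (simp add: test_function_zero_outside has_integral_Icc_iff_Ioo)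
  moreover have "integrable (lebesgue_on {0<..<T}) h"
    unfolding h_def by (intro Bochner_Integration.integrable_add int contf f')
  ultimately have "(LINT t|lebesgue_on {0<..<T}. h t) = 0"
    by (simp add: lebesgue_integral_eq_integral integral_unique)
  moreover have "(LINT t|lebesgue_on {0<..<T}. h t) =
      (LINT t|lebesgue_on {0<..<T}. complex_of_real ((deriv ^^ n) \<phi> t) * f' t) +
      (LINT t|lebesgue_on {0<..<T}. complex_of_real ((deriv ^^ Suc n) \<phi> t) * f t)"
    unfolding h_def by (intro Bochner_Integration.integral_add int contf f')
  ultimately show ?thesis
    by (simp only: eq_neg_iff_add_eq_0 add.commute)
qed

end

text \<open>The family \<open>f\<close> carries the smooth function \<open>f 0\<close> together with
  all its derivatives.\<close>

lemma weak_derivative_smooth: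
  assumes T: "0 < T"
    and f: "\<And>n t. (f n has_vector_derivative f (Suc n) t) (at t)"
  shows "weak_derivative T n (f 0) (f n)"
proof -
  have cont: "continuous_on UNIV (f n)" for n
    using f by (intro continuous_at_imp_continuous_on ballI) (rule has_vector_derivative_continuous)
  \<comment> \<open>Each integration by parts raises the index of \<open>f\<close>, so the induction
    needs an arbitrary starting index \<open>j\<close>.\<close>
  have "(LINT t|lebesgue_on {0<..<T}. complex_of_real ((deriv ^^ n) \<phi> t) * f j t) =
      (- 1) ^ n * (LINT t|lebesgue_on {0<..<T}. complex_of_real (\<phi> t) * f (n + j) t)"
    if "test_function T \<phi>" for \<phi> j
  proof (induction n arbitrary: j)
    case (Suc n)
    have "(LINT t|lebesgue_on {0<..<T}. complex_of_real ((deriv ^^ Suc n) \<phi> t) * f j t) =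
        - (LINT t|lebesgue_on {0<..<T}. complex_of_real ((deriv ^^ n) \<phi> t) * f (Suc j) t)"
      by (rule test_function_by_parts[OF that T f cont])
    also have "\<dots> = (- 1) ^ Suc n * (LINT t|lebesgue_on {0<..<T}. complex_of_real (\<phi> t) * f (Suc n + j) t)"
      unfolding Suc by simp
    finally show ?case .
  qed simp
  from this[of _ 0] show ?thesis
    by (simp add: weak_derivative_def)
qed

lemma weak_derivative_add:
  assumes "weak_derivative T n f1 h1" "weak_derivative T n f2 h2"
    and "f1 \<in> L2_space T" "f2 \<in> L2_space T" "h1 \<in> L2_space T" "h2 \<in> L2_space T"
  shows "weak_derivative T n (\<lambda>t. f1 t + f2 t) (\<lambda>t. h1 t + h2 t)"
  unfolding weak_derivative_def
proof (intro allI impI)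
  fix \<phi> assume \<phi>: "test_function T \<phi>"
  note int = integrable_test_function_mult[OF \<phi> L2_space_integrable]
  show "(LINT t|lebesgue_on {0<..<T}. complex_of_real ((deriv ^^ n) \<phi> t) * (f1 t + f2 t)) =
      (- 1) ^ n * (LINT t|lebesgue_on {0<..<T}. complex_of_real (\<phi> t) * (h1 t + h2 t))"
  proof -
    have "(LINT t|lebesgue_on {0<..<T}. complex_of_real ((deriv ^^ n) \<phi> t) * (f1 t + f2 t)) =
        (LINT t|lebesgue_on {0<..<T}. complex_of_real ((deriv ^^ n) \<phi> t) * f1 t) +
        (LINT t|lebesgue_on {0<..<T}. complex_of_real ((deriv ^^ n) \<phi> t) * f2 t)"
      unfolding distrib_left by (intro Bochner_Integration.integral_add int assms)
    \<comment> \<open>Writing \<phi> as its zeroth derivative lets the same integrability fact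
      \<open>int\<close> cover this side.\<close>
    also have "\<dots> = (- 1) ^ n * ((LINT t|lebesgue_on {0<..<T}. complex_of_real ((deriv ^^ 0) \<phi> t) * h1 t) +
        (LINT t|lebesgue_on {0<..<T}. complex_of_real ((deriv ^^ 0) \<phi> t) * h2 t))"
      using assms(1,2) \<phi> by (simp add: weak_derivative_def distrib_left)
    also have "\<dots> = (- 1) ^ n * (LINT t|lebesgue_on {0<..<T}. complex_of_real ((deriv ^^ 0) \<phi> t) * (h1 t + h2 t))"
      unfolding distrib_left[of "complex_of_real _"]
      by (subst Bochner_Integration.integral_add) (intro int assms refl)+
    finally show ?thesis by simp
  qed
qed

section \<open>Stability of the Gagliardo seminorm under Lipschitz perturbations\<close>

lemma nn_integral_powr_abs_finite:
  fixes p T :: real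
  assumes p: "p > - 1" and T: "T > 0"
  shows "(\<integral>\<^sup>+ u. ennreal (\<bar>u\<bar> powr p) * indicator {-T..T} u \<partial>lborel) < \<infinity>"
proof -
  have half: "(\<integral>\<^sup>+ u. ennreal (\<bar>u\<bar> powr p) * indicator {0..T} u \<partial>lborel) = ennreal (T powr (p + 1) / (p + 1))"
  proof -
    have "((\<lambda>u. u powr p) has_integral (T powr (p + 1) / (p + 1))) {0..T}"
      using has_integral_powr_from_0[of p T] p T by simp
    then have "((\<lambda>u. \<bar>u\<bar> powr p) has_integral (T powr (p + 1) / (p + 1))) {0..T}"
      by (rule has_integral_eq[rotated]) simp
    then show ?thesis
      by (rule nn_integral_has_integral_lebesgue'[rotated]) simp
  qed
  have "(\<integral>\<^sup>+ u. ennreal (\<bar>u\<bar> powr p) * indicator {-T..T} u \<partial>lborel) \<le>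
      (\<integral>\<^sup>+ u. ennreal (\<bar>u\<bar> powr p) * indicator {0..T} u + ennreal (\<bar>-u\<bar> powr p) * indicator {0..T} (-u) \<partial>lborel)"
    by (intro nn_integral_mono) (auto split: split_indicator)
  also have "\<dots> = (\<integral>\<^sup>+ u. ennreal (\<bar>u\<bar> powr p) * indicator {0..T} u \<partial>lborel) +
      (\<integral>\<^sup>+ u. ennreal (\<bar>-u\<bar> powr p) * indicator {0..T} (-u) \<partial>lborel)"
    by (intro nn_integral_add) measurable
  also have "(\<integral>\<^sup>+ u. ennreal (\<bar>-u\<bar> powr p) * indicator {0..T} (-u) \<partial>lborel) =
      (\<integral>\<^sup>+ u. ennreal (\<bar>u\<bar> powr p) * indicator {0..T} u \<partial>lborel)"
    using nn_integral_real_affine[of "\<lambda>u. ennreal (\<bar>u\<bar> powr p) * indicator {0..T} u" "-1" 0] by simp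
  finally show ?thesis
    unfolding half by (rule le_less_trans) (simp add: ennreal_add_less_top)
qed

text \<open>Since |a + b|^2 \<le> 2 |a|^2 + 2 |b|^2, the Lipschitz part adds at most 2 L^2 |s - t|^p
  to the integrand with p = 2 - (1 + 2 \<sigma>). As \<sigma> < 1, p exceeds - 1 and this is
  integrable across the diagonal.\<close>

lemma gagliardo_add_Lipschitz_finite:
  assumes T: "0 < T" and \<sigma>: "\<sigma> < 1"
    and h: "h \<in> borel_measurable (lebesgue_on {0<..<T})" and fin: "gagliardo T \<sigma> h < \<infinity>"
    and f: "\<And>s t. s \<in> {0<..<T} \<Longrightarrow> t \<in> {0<..<T} \<Longrightarrow> norm (f s - f t) \<le> L * \<bar>s - t\<bar>"
  shows "gagliardo T \<sigma> (\<lambda>t. h t + f t) < \<infinity>"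
proof -
  let ?M = "lebesgue_on {0<..<T}"
  interpret finite_measure ?M by (rule finite_measure_lebesgue_on_Ioo)
  note [measurable] = h
  have [measurable]: "(\<lambda>x::real. x) \<in> borel_measurable ?M"
    by (rule borel_measurable_lebesgue_on_continuous) auto
  define p where "p = 1 - 2 * \<sigma>"
  define J where "J = (\<integral>\<^sup>+ u. ennreal (\<bar>u\<bar> powr p) * indicator {-T..T} u \<partial>lborel)"
  have J: "J < \<infinity>"
    unfolding J_def using \<sigma> T by (intro nn_integral_powr_abs_finite) (auto simp: p_def)
  define I where "I s = (\<integral>\<^sup>+ t. ennreal ((norm (h s - h t))\<^sup>2 / \<bar>s - t\<bar> powr (1 + 2 * \<sigma>)) \<partial>?M)" for s
  have I_meas [measurable]: "I \<in> borel_measurable ?M"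
    unfolding I_def by measurable
  \<comment> \<open>Translation by s moves the interval into [-T, T], which yields a bound
    independent of s.\<close>
  have inner_J: "(\<integral>\<^sup>+ t. ennreal (\<bar>s - t\<bar> powr p) \<partial>?M) \<le> J" if s: "s \<in> {0<..<T}" for s
  proof -
    have "(\<integral>\<^sup>+ t. ennreal (\<bar>s - t\<bar> powr p) \<partial>?M) =
        (\<integral>\<^sup>+ t. ennreal (\<bar>s - t\<bar> powr p) * indicator {0<..<T} t \<partial>lebesgue)"
      by (rule nn_integral_restrict_space) auto
    also have "\<dots> = (\<integral>\<^sup>+ t. ennreal (\<bar>s - t\<bar> powr p) * indicator {0<..<T} t \<partial>lborel)"
      by (rule nn_integral_completion)
    also have "\<dots> \<le> (\<integral>\<^sup>+ t. ennreal (\<bar>- s + 1 * t\<bar> powr p) * indicator {-T..T} (- s + 1 * t) \<partial>lborel)"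
      using s by (intro nn_integral_mono) (auto split: split_indicator simp: abs_minus_commute)
    also have "\<dots> = J"
      unfolding J_def by (subst (2) nn_integral_real_affine[where c = 1 and t = "- s"]) auto
    finally show ?thesis .
  qed
  have pointwise: "(norm (h s + f s - (h t + f t)))\<^sup>2 / \<bar>s - t\<bar> powr (1 + 2 * \<sigma>) \<le>
      2 * ((norm (h s - h t))\<^sup>2 / \<bar>s - t\<bar> powr (1 + 2 * \<sigma>)) + 2 * L\<^sup>2 * \<bar>s - t\<bar> powr p"
    if st: "s \<in> {0<..<T}" "t \<in> {0<..<T}" for s t
  proof (cases "s = t")
    case False
    have "(norm (h s + f s - (h t + f t)))\<^sup>2 \<le> 2 * (norm (h s - h t))\<^sup>2 + 2 * (norm (f s - f t))\<^sup>2"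
      using norm_add_power2_le[of "h s - h t" "f s - f t"] by (simp add: algebra_simps)
    moreover have "(norm (f s - f t))\<^sup>2 \<le> L\<^sup>2 * \<bar>s - t\<bar>\<^sup>2"
      using power_mono[OF f[OF st] norm_ge_zero, of 2] by (simp add: power_mult_distrib)
    ultimately have "(norm (h s + f s - (h t + f t)))\<^sup>2 / \<bar>s - t\<bar> powr (1 + 2 * \<sigma>) \<le>
        (2 * (norm (h s - h t))\<^sup>2 + 2 * (L\<^sup>2 * \<bar>s - t\<bar>\<^sup>2)) / \<bar>s - t\<bar> powr (1 + 2 * \<sigma>)"
      by (intro divide_right_mono) auto
    moreover have "\<bar>s - t\<bar>\<^sup>2 / \<bar>s - t\<bar> powr (1 + 2 * \<sigma>) = \<bar>s - t\<bar> powr p"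
    proof -
      have "\<bar>s - t\<bar>\<^sup>2 = \<bar>s - t\<bar> powr 2" using False by simp
      then show ?thesis by (simp only: p_def powr_diff [symmetric]) simp
    qed
    ultimately show ?thesis
      by (simp add: add_divide_distrib flip: times_divide_eq_right)
  qed simp
  have "gagliardo T \<sigma> (\<lambda>t. h t + f t) \<le> (\<integral>\<^sup>+ s. 2 * I s + ennreal (2 * L\<^sup>2) * J \<partial>?M)"
    unfolding gagliardo_def
  proof (rule nn_integral_mono)
    fix s assume "s \<in> space ?M"
    then have s: "s \<in> {0<..<T}" by (simp add: space_restrict_space)
    have "(\<integral>\<^sup>+ t. ennreal ((norm (h s + f s - (h t + f t)))\<^sup>2 / \<bar>s - t\<bar> powr (1 + 2 * \<sigma>)) \<partial>?M) \<le>
        (\<integral>\<^sup>+ t. 2 * ennreal ((norm (h s - h t))\<^sup>2 / \<bar>s - t\<bar> powr (1 + 2 * \<sigma>)) + ennreal (2 * L\<^sup>2) * ennreal (\<bar>s - t\<bar> powr p) \<partial>?M)"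
    proof (rule nn_integral_mono)
      fix t assume "t \<in> space ?M"
      then have "t \<in> {0<..<T}" by (simp add: space_restrict_space)
      from pointwise[OF s this]
      show "ennreal ((norm (h s + f s - (h t + f t)))\<^sup>2 / \<bar>s - t\<bar> powr (1 + 2 * \<sigma>)) \<le>
          2 * ennreal ((norm (h s - h t))\<^sup>2 / \<bar>s - t\<bar> powr (1 + 2 * \<sigma>)) + ennreal (2 * L\<^sup>2) * ennreal (\<bar>s - t\<bar> powr p)"
        by (simp add: ennreal_leI flip: ennreal_plus ennreal_mult ennreal_numeral)
    qed
    also have "\<dots> = 2 * I s + ennreal (2 * L\<^sup>2) * (\<integral>\<^sup>+ t. ennreal (\<bar>s - t\<bar> powr p) \<partial>?M)"
    proof -
      have m1: "(\<lambda>t. ennreal ((norm (h s - h t))\<^sup>2 / \<bar>s - t\<bar> powr (1 + 2 * \<sigma>))) \<in> borel_measurable ?M" by measurable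
      have m2: "(\<lambda>t. ennreal (\<bar>s - t\<bar> powr p)) \<in> borel_measurable ?M" by measurable
      show ?thesis
        unfolding I_def nn_integral_cmult[OF m1, symmetric] nn_integral_cmult[OF m2, symmetric]
        by (intro nn_integral_add borel_measurable_times_ennreal borel_measurable_const m1 m2)
    qed
    also have "\<dots> \<le> 2 * I s + ennreal (2 * L\<^sup>2) * J"
      by (intro add_left_mono mult_left_mono inner_J s) auto
    finally show "(\<integral>\<^sup>+ t. ennreal ((norm (h s + f s - (h t + f t)))\<^sup>2 / \<bar>s - t\<bar> powr (1 + 2 * \<sigma>)) \<partial>?M) \<le>
        2 * I s + ennreal (2 * L\<^sup>2) * J" .
  qed
  also have "\<dots> = 2 * gagliardo T \<sigma> h + ennreal (2 * L\<^sup>2) * J * emeasure ?M (space ?M)"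
    unfolding gagliardo_def I_def[symmetric] by (simp add: nn_integral_add nn_integral_cmult)
  also have "\<dots> < \<infinity>"
    using fin J finite_emeasure_space by (auto simp: ennreal_mult_less_top less_top[symmetric] ennreal_mult_eq_top_iff)
  finally show ?thesis .
qed

text \<open>Weak derivatives add. At the top order, the next derivative of the smooth part is
  bounded on [0, T], so that part is Lipschitz there and keeps the seminorm finite.\<close>

lemma sobolev_add_smooth:
  assumes T: "0 < T" and m: "0 \<le> m" and g: "g \<in> sobolev m T"
    and f: "\<And>n t. (f n has_vector_derivative f (Suc n) t) (at t)"
  shows "(\<lambda>t. g t + f 0 t) \<in> sobolev m T"
proof -
  have cont: "continuous_on UNIV (f n)" for n
    using f by (intro continuous_at_imp_continuous_on ballI) (rule has_vector_derivative_continuous)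
  have L2: "f n \<in> L2_space T" for n
    by (rule continuous_L2_space[OF cont])
  have gL2: "g \<in> L2_space T" using g by (simp add: sobolev_def)
  have add: "(\<lambda>t. h t + f n t) \<in> L2_space T \<and> weak_derivative T n (\<lambda>t. g t + f 0 t) (\<lambda>t. h t + f n t)"
    if "h \<in> L2_space T" "weak_derivative T n g h" for n h
    using that by (intro conjI L2_space_add weak_derivative_add weak_derivative_smooth T f gL2 L2)
  have top: "\<exists>h\<in>L2_space T. weak_derivative T (nat \<lfloor>m\<rfloor>) (\<lambda>t. g t + f 0 t) h \<and> gagliardo T (m - of_int \<lfloor>m\<rfloor>) h < \<infinity>"
    if "m \<notin> \<int>"
  proof -
    define n where "n = nat \<lfloor>m\<rfloor>"
    obtain h where h: "h \<in> L2_space T" "weak_derivative T n g h" "gagliardo T (m - of_int \<lfloor>m\<rfloor>) h < \<infinity>"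
      using g \<open>m \<notin> \<int>\<close> unfolding sobolev_def n_def by blast
    obtain L where L: "\<And>t. t \<in> {0..T} \<Longrightarrow> norm (f (Suc n) t) \<le> L"
      using continuous_bounded_Icc[OF cont] by blast
    have "gagliardo T (m - of_int \<lfloor>m\<rfloor>) (\<lambda>t. h t + f n t) < \<infinity>"
    proof (rule gagliardo_add_Lipschitz_finite[OF T _ _ h(3)])
      show "m - of_int \<lfloor>m\<rfloor> < 1" by linarith
      show "h \<in> borel_measurable (lebesgue_on {0<..<T})" using h(1) by (simp add: L2_space_def)
      fix s t assume st: "s \<in> {0<..<T}" "t \<in> {0<..<T}"
      have "norm (f n s - f n t) \<le> L * norm (s - t)"
      proof (rule differentiable_bound[of "{0..T}"])
        fix x assume x: "x \<in> {0..T}"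
        show "(f n has_derivative (\<lambda>r. r *\<^sub>R f (Suc n) x)) (at x within {0..T})"
          using f[of n x] by (simp add: has_vector_derivative_def has_derivative_at_withinI)
        show "onorm (\<lambda>r. r *\<^sub>R f (Suc n) x) \<le> L"
          by (rule onorm_le) (use L[OF x] in \<open>simp add: mult.commute[of L] mult_left_mono\<close>)
      qed (use st in auto)
      then show "norm (f n s - f n t) \<le> L * \<bar>s - t\<bar>" by simp
    qed
    then show ?thesis using add[OF h(1,2)] unfolding n_def by blast
  qed
  have low: "\<exists>h\<in>L2_space T. weak_derivative T n (\<lambda>t. g t + f 0 t) h" if "n \<le> nat \<lfloor>m\<rfloor>" for n
  proof -
    from g that have "\<exists>h\<in>L2_space T. weak_derivative T n g h"
      by (simp add: sobolev_def)
    then obtain h where h: "h \<in> L2_space T" "weak_derivative T n g h" ..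
    show ?thesis
      using add[OF h] by (intro bexI[of _ "\<lambda>t. h t + f n t"]) simp_all
  qed
  show ?thesis
    unfolding sobolev_def mem_Collect_eq
    by (intro conjI allI impI L2_space_add gL2 L2 top low)
qed

lemma zero_in_sobolev: "(\<lambda>_. 0) \<in> sobolev m T"
proof -
  have "(\<lambda>_. 0) \<in> L2_space T" "weak_derivative T n (\<lambda>_. 0) (\<lambda>_. 0)" "gagliardo T \<sigma> (\<lambda>_. 0) < \<infinity>" for n \<sigma>
    by (simp_all add: L2_space_def weak_derivative_def gagliardo_def)
  then show ?thesis by (auto simp: sobolev_def)
qed

lemma uminus_smooth_in_sobolev:
  assumes T: "0 < T" and m: "0 \<le> m"
    and f: "\<And>n t. (f n has_vector_derivative f (Suc n) t) (at t)"
  shows "(\<lambda>t. - f 0 t) \<in> sobolev m T"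
  using sobolev_add_smooth[OF T m zero_in_sobolev, of "\<lambda>n t. - f n t", OF has_vector_derivative_minus[OF f]]
  by simp

section \<open>The solution formulae as convolutions\<close>

text \<open>\<open>h\<close> is the spatial factor and \<open>E\<close> its symbol. At k^2 = \<i>
  \<tau> the time factor and the transform of \<open>f\<close> combine into the integral of cis (-
  \<tau> (t - z)) f z, and Fubini moves the \<tau> integral inside; the constants agree because \<i>
  / 2 divided by \<i> pi is 1 / (2 pi).\<close>

lemma t_transform_solution_eq:
  assumes E: "integrable lborel E" "\<And>\<tau>. h (root_i \<tau>) = E \<tau>"
    and f: "integrable (lebesgue_on {0<..<t}) f"
  shows "1 / (\<i> * of_real pi) * sector_boundary_integral
      (\<lambda>k. h k * exp (- (k\<^sup>2 * of_real t)) * k * t_transform f (k\<^sup>2) t) =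
    (LINT z|lebesgue_on {0<..<t}. inv_fourier E (t - z) * f z)"
proof -
  interpret finite_measure "lebesgue_on {0<..<t}" by (rule finite_measure_lebesgue_on_Ioo)
  have id_meas: "(\<lambda>z::real. t - z) \<in> borel_measurable (lebesgue_on {0<..<t})"
    by (rule borel_measurable_lebesgue_on_continuous) (auto intro!: continuous_intros)
  define G where "G k = h k * exp (- (k\<^sup>2 * of_real t)) * t_transform f (k\<^sup>2) t" for k
  have G: "G (root_i \<tau>) = E \<tau> * (LINT z|lebesgue_on {0<..<t}. cis (- (\<tau> * (t - z))) * f z)" for \<tau>
  proof -
    have "cis (- (\<tau> * (t - z))) * f z = exp (- (\<i> * of_real \<tau> * of_real t)) * (exp (\<i> * of_real \<tau> * of_real z) * f z)" for z
      by (simp add: cis_conv_exp algebra_simps flip: exp_add)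
    then have "(LINT z|lebesgue_on {0<..<t}. cis (- (\<tau> * (t - z))) * f z) =
        exp (- (\<i> * of_real \<tau> * of_real t)) * t_transform f (\<i> * of_real \<tau>) t"
      unfolding t_transform_def by (simp only: integral_mult_right_zero)
    then show ?thesis
      by (simp add: G_def E(2) root_i_power2)
  qed
  note fub = integral_inv_fourier_mult[OF sigma_finite_measure_axioms E(1) f id_meas]
  have "sector_boundary_integral (\<lambda>k. h k * exp (- (k\<^sup>2 * of_real t)) * k * t_transform f (k\<^sup>2) t) =
      sector_boundary_integral (\<lambda>k. G k * k)"
    by (simp add: G_def mult_ac)
  also have "\<dots> = \<i> / 2 * (LINT \<tau>|lborel. G (root_i \<tau>))"
    by (rule sector_boundary_integral_eq) (use fub(2) in \<open>simp add: G\<close>)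
  finally have eq: "sector_boundary_integral (\<lambda>k. h k * exp (- (k\<^sup>2 * of_real t)) * k * t_transform f (k\<^sup>2) t) =
      \<i> / 2 * (LINT \<tau>|lborel. G (root_i \<tau>))" .
  show ?thesis
    unfolding fub(1) eq G by (simp add: field_simps)
qed

lemma right_half_line_solution_eq:
  assumes "x > 0" "integrable (lebesgue_on {0<..<t}) a"
  shows "right_half_line_solution a x t =
    (LINT z|lebesgue_on {0<..<t}. inv_fourier (heat_symbol x) (t - z) * a z)"
proof -
  have "exp (\<i> * k * of_real x - k\<^sup>2 * of_real t) = exp (\<i> * k * of_real x) * exp (- (k\<^sup>2 * of_real t))" for k
    by (simp flip: exp_add)
  then show ?thesis
    unfolding right_half_line_solution_def
    using t_transform_solution_eq[of "heat_symbol x" "\<lambda>k. exp (\<i> * k * of_real x)" t a] assms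
    by (simp only: integrable_heat_symbol heat_symbol_def)
qed

lemma left_half_line_solution_eq:
  assumes "x < l" "integrable (lebesgue_on {0<..<t}) b"
  shows "left_half_line_solution l b x t =
    (LINT z|lebesgue_on {0<..<t}. inv_fourier (heat_symbol (l - x)) (t - z) * b z)"
  using right_half_line_solution_eq[of "l - x" t b] assms
  by (simp add: right_half_line_solution_def left_half_line_solution_def)

text \<open>Write both sines as differences of e y and e (- y), and multiply numerator and
  denominator by - e l.\<close>

lemma sin_quotient_eq_resolvent_symbol:
  assumes l: "l > 0"
  shows "sin (root_i \<tau> * of_real (l - x)) / sin (root_i \<tau> * of_real l) =
    resolvent_symbol l x \<tau> - resolvent_symbol l (2 * l - x) \<tau>"
proof (cases "\<tau> = 0")
  \<comment> \<open>Both sides are 0 here, by the convention for division by 0.\<close>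
  case True
  then have "root_i \<tau> = 0" by (simp add: root_i_eq_0_iff)
  then show ?thesis
    by (simp add: resolvent_symbol_def heat_symbol_def)
next
  case False
  define e where "e y = heat_symbol y \<tau>" for y
  have e: "e y \<noteq> 0" "e (- y) = inverse (e y)" for y
    by (simp_all add: e_def heat_symbol_def exp_minus)
  have add: "e (y + z) = e y * e z" for y z
    by (simp add: e_def heat_symbol_mult)
  have sin: "sin (root_i \<tau> * of_real y) = (e y - e (- y)) / (2 * \<i>)" for y
    by (simp add: sin_exp_eq e_def heat_symbol_def mult.assoc)
  have "e (2 * l) \<noteq> 1"
    using norm_heat_symbol_less_1[of "2 * l" \<tau>] l False by (auto simp: e_def)
  then have ne: "e l * e l \<noteq> 1"
    using add[of l l] by simp
  have shift: "e (l - x) = e l / e x" "e (- (l - x)) = e x / e l" "e (2 * l) = e l * e l" "e (2 * l - x) = e l * e l / e x"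
    using add[of l "- x"] add[of "- l" x] add[of l l] add[of "2 * l" "- x"] by (simp_all add: e divide_inverse mult.commute)
  have "sin (root_i \<tau> * of_real (l - x)) / sin (root_i \<tau> * of_real l) =
      (e l / e x - e x / e l) / (e l - inverse (e l))"
    unfolding sin shift by (simp add: e)
  also have "\<dots> = (e x - e l * e l / e x) / (1 - e l * e l)"
    using e(1)[of l] e(1)[of x] ne by (simp add: field_simps)
  finally show ?thesis
    using shift(3,4)
    by (simp add: resolvent_symbol_def diff_divide_distrib flip: e_def)
qed

lemma interval_solution_eq:
  assumes x: "x \<in> {0<..<l}" and g: "integrable (lebesgue_on {0<..<t}) g"
  shows "interval_solution l g x t = (LINT z|lebesgue_on {0<..<t}.
    inv_fourier (\<lambda>\<tau>. resolvent_symbol l x \<tau> - resolvent_symbol l (2 * l - x) \<tau>) (t - z) * g z)"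
  unfolding interval_solution_def
proof (rule t_transform_solution_eq[where
      h = "\<lambda>k. sin (k * of_real (l - x)) / sin (k * of_real l)", OF _ _ g])
  show "sin (root_i \<tau> * of_real (l - x)) / sin (root_i \<tau> * of_real l) =
      resolvent_symbol l x \<tau> - resolvent_symbol l (2 * l - x) \<tau>" for \<tau>
    using x by (intro sin_quotient_eq_resolvent_symbol) auto
qed (use x in \<open>auto intro!: Bochner_Integration.integrable_diff integrable_resolvent_symbol\<close>)

lemma inv_fourier_add:
  assumes "integrable lborel H" "integrable lborel K"
  shows "inv_fourier (\<lambda>\<tau>. H \<tau> + K \<tau>) s = inv_fourier H s + inv_fourier K s"
proof -
  have "(LINT \<tau>|lborel. cis (- (\<tau> * s)) * H \<tau> + cis (- (\<tau> * s)) * K \<tau>) =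
      (LINT \<tau>|lborel. cis (- (\<tau> * s)) * H \<tau>) + (LINT \<tau>|lborel. cis (- (\<tau> * s)) * K \<tau>)"
    by (intro Bochner_Integration.integral_add integrable_cis_mult assms) measurable
  then show ?thesis
    by (simp add: inv_fourier_def distrib_left add_divide_distrib)
qed

lemma inv_fourier_diff:
  assumes "integrable lborel H" "integrable lborel K"
  shows "inv_fourier (\<lambda>\<tau>. H \<tau> - K \<tau>) s = inv_fourier H s - inv_fourier K s"
proof -
  have "(LINT \<tau>|lborel. cis (- (\<tau> * s)) * H \<tau> - cis (- (\<tau> * s)) * K \<tau>) =
      (LINT \<tau>|lborel. cis (- (\<tau> * s)) * H \<tau>) - (LINT \<tau>|lborel. cis (- (\<tau> * s)) * K \<tau>)"
    by (intro Bochner_Integration.integral_diff integrable_cis_mult assms) measurable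
  then show ?thesis
    by (simp add: inv_fourier_def right_diff_distrib diff_divide_distrib)
qed

lemma inv_fourier_cong_AE:
  assumes "AE \<tau> in lborel. H \<tau> = K \<tau>" and [measurable]: "H \<in> borel_measurable borel" "K \<in> borel_measurable borel"
  shows "inv_fourier H s = inv_fourier K s"
  unfolding inv_fourier_def using assms(1)
  by (intro arg_cong2[where f = "(*)"] refl integral_cong_AE) auto

section \<open>Symbols multiplied by the transform of the boundary datum\<close>

definition interval_fourier :: "real \<Rightarrow> (real \<Rightarrow> complex) \<Rightarrow> real \<Rightarrow> complex" where
  "interval_fourier T g \<tau> = (LINT z|lebesgue_on {0<..<T}. cis (\<tau> * z) * g z)"

context
  fixes T :: real and g :: "real \<Rightarrow> complex"
  assumes g: "integrable (lebesgue_on {0<..<T}) g"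
begin

lemma integrable_lebesgue_on_subinterval:
  assumes "t \<le> T"
  shows "integrable (lebesgue_on {0<..<t}) g"
proof -
  have "integrable lebesgue (\<lambda>z. indicator {0<..<t} z *\<^sub>R (indicator {0<..<T} z *\<^sub>R g z))"
    using g by (intro integrable_mult_indicator[of "{0<..<t}"]) (simp_all add: integrable_restrict_space)
  also have "(\<lambda>z. indicator {0<..<t} z *\<^sub>R (indicator {0<..<T} z *\<^sub>R g z)) = (\<lambda>z. indicator {0<..<t} z *\<^sub>R g z)"
    using assms by (auto simp: fun_eq_iff split: split_indicator)
  finally show ?thesis by (simp add: integrable_restrict_space)
qed

lemma borel_measurable_interval_fourier [measurable]: "interval_fourier T g \<in> borel_measurable borel"
proof -
  interpret finite_measure "lebesgue_on {0<..<T}" by (rule finite_measure_lebesgue_on_Ioo)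
  have [measurable]: "g \<in> borel_measurable (lebesgue_on {0<..<T})" using g by auto
  have [measurable]: "(\<lambda>z::real. z) \<in> borel_measurable (lebesgue_on {0<..<T})"
    by (rule borel_measurable_lebesgue_on_continuous) auto
  show ?thesis
    unfolding interval_fourier_def by measurable
qed

lemma norm_interval_fourier_le:
  "norm (interval_fourier T g \<tau>) \<le> (LINT z|lebesgue_on {0<..<T}. norm (g z))"
  unfolding interval_fourier_def by (rule order_trans[OF integral_norm_bound]) (simp add: norm_mult)

lemma integrable_mult_interval_fourier:
  assumes "integrable lborel E"
  shows "integrable lborel (\<lambda>\<tau>. E \<tau> * interval_fourier T g \<tau>)"
  using integrable_bounded_mult[OF assms _ norm_interval_fourier_le] by (simp add: mult.commute)

lemma inv_fourier_mult_interval_fourier: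
  assumes E: "integrable lborel E"
  shows "inv_fourier (\<lambda>\<tau>. E \<tau> * interval_fourier T g \<tau>) s =
    (LINT z|lebesgue_on {0<..<T}. inv_fourier E (s - z) * g z)"
proof -
  interpret finite_measure "lebesgue_on {0<..<T}" by (rule finite_measure_lebesgue_on_Ioo)
  have meas: "(\<lambda>z::real. s - z) \<in> borel_measurable (lebesgue_on {0<..<T})"
    by (rule borel_measurable_lebesgue_on_continuous) (auto intro!: continuous_intros)
  have "(LINT z|lebesgue_on {0<..<T}. cis (- (\<tau> * (s - z))) * g z) = cis (- (\<tau> * s)) * interval_fourier T g \<tau>" for \<tau>
  proof -
    have "cis (- (\<tau> * (s - z))) * g z = cis (- (\<tau> * s)) * (cis (\<tau> * z) * g z)" for z
      by (simp add: cis_mult algebra_simps flip: mult.assoc)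
    then show ?thesis
      by (simp only: interval_fourier_def integral_mult_right_zero)
  qed
  then show ?thesis
    unfolding integral_inv_fourier_mult(1)[OF sigma_finite_measure_axioms E g meas]
    by (simp add: inv_fourier_def mult_ac)
qed

lemma causal_mult_interval_fourier:
  assumes E: "integrable lborel E" "\<And>s. s \<le> 0 \<Longrightarrow> inv_fourier E s = 0" and s: "s \<le> 0"
  shows "inv_fourier (\<lambda>\<tau>. E \<tau> * interval_fourier T g \<tau>) s = 0"
  unfolding inv_fourier_mult_interval_fourier[OF E(1)]
  by (rule integral_eq_zero_AE) (use E(2) s in \<open>auto intro!: AE_I2 simp: space_restrict_space\<close>)

text \<open>For z \<ge> t the kernel is taken at t - z \<le> 0 and vanishes, so the integral may be
  extended from (0,t) to (0,T). This replaces the transform up to time t by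
  \<open>interval_fourier\<close>, which does not depend on t.\<close>

lemma causal_convolution_interval:
  assumes E: "integrable lborel E" "\<And>s. s \<le> 0 \<Longrightarrow> inv_fourier E s = 0" and t: "t \<le> T"
  shows "(LINT z|lebesgue_on {0<..<t}. inv_fourier E (t - z) * g z) =
    inv_fourier (\<lambda>\<tau>. E \<tau> * interval_fourier T g \<tau>) t"
proof -
  have "(LINT z|lebesgue_on {0<..<t}. inv_fourier E (t - z) * g z) =
      (LINT z|lebesgue. indicator {0<..<t} z *\<^sub>R (inv_fourier E (t - z) * g z))"
    by (intro integral_restrict_space) auto
  also have "\<dots> = (LINT z|lebesgue. indicator {0<..<T} z *\<^sub>R (inv_fourier E (t - z) * g z))"
    using t E(2) by (intro Bochner_Integration.integral_cong) (auto split: split_indicator)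
  also have "\<dots> = (LINT z|lebesgue_on {0<..<T}. inv_fourier E (t - z) * g z)"
    by (intro integral_restrict_space[symmetric]) auto
  finally show ?thesis
    by (simp only: inv_fourier_mult_interval_fourier[OF E(1)])
qed

text \<open>An instance of \<open>causal_convolution\<close> in which the heat symbol, continuous
  and bounded by 1, is \<open>F\<close>. The resolvent symbol is singular at 0 and goes into
  \<open>H\<close>, where integrability suffices.\<close>

lemma causal_convolution_resolvent:
  assumes l: "l > 0" and y: "y > 0" and x: "x > 0"
  shows "(LINT z|lebesgue_on {0<..<t}. inv_fourier (heat_symbol x) (t - z) *
      inv_fourier (\<lambda>\<tau>. resolvent_symbol l y \<tau> * interval_fourier T g \<tau>) z) =
    inv_fourier (\<lambda>\<tau>. resolvent_symbol l (x + y) \<tau> * interval_fourier T g \<tau>) t"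
proof -
  note R = integrable_resolvent_symbol[OF l y] inv_fourier_resolvent_symbol_causal[OF l y]
  have "(LINT z|lebesgue_on {0<..<t}. inv_fourier (heat_symbol x) (t - z) *
      inv_fourier (\<lambda>\<tau>. resolvent_symbol l y \<tau> * interval_fourier T g \<tau>) z) =
      inv_fourier (\<lambda>\<tau>. resolvent_symbol l y \<tau> * interval_fourier T g \<tau> * heat_symbol x \<tau>) t"
    using x by (intro causal_convolution integrable_mult_interval_fourier causal_mult_interval_fourier R
        integrable_heat_symbol inv_fourier_heat_symbol_causal continuous_heat_symbol norm_heat_symbol_le_1) auto
  also have "(\<lambda>\<tau>. resolvent_symbol l y \<tau> * interval_fourier T g \<tau> * heat_symbol x \<tau>) =
      (\<lambda>\<tau>. resolvent_symbol l (x + y) \<tau> * interval_fourier T g \<tau>)"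
    by (simp add: mult_ac flip: heat_symbol_mult_resolvent_symbol)
  finally show ?thesis .
qed

text \<open>Index 0 is the function produced by the solution formulae; each factor - \<i> \<tau>
  comes from differentiating cis (- \<tau> t) in time. The family has the shape that
  \<open>sobolev_add_smooth\<close> expects.\<close>

definition resolvent_deriv :: "real \<Rightarrow> real \<Rightarrow> nat \<Rightarrow> real \<Rightarrow> complex" where
  "resolvent_deriv l y n =
    inv_fourier (\<lambda>\<tau>. (- \<i> * of_real \<tau>) ^ n * (resolvent_symbol l y \<tau> * interval_fourier T g \<tau>))"

lemma resolvent_deriv_has_vector_derivative:
  assumes "l > 0" "y > 0"
  shows "(resolvent_deriv l y n has_vector_derivative resolvent_deriv l y (Suc n) t) (at t)"
proof -
  define H where "H n \<tau> = (- \<i> * of_real \<tau>) ^ n * (resolvent_symbol l y \<tau> * interval_fourier T g \<tau>)" for n \<tau>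
  have H: "integrable lborel (\<lambda>\<tau>. of_real \<tau> ^ j * (resolvent_symbol l y \<tau> * interval_fourier T g \<tau>))" for j
    using integrable_mult_interval_fourier[OF integrable_power_resolvent_symbol[OF assms, of j]] by (simp add: mult.assoc)
  have eq: "H n = (\<lambda>\<tau>. (- \<i>) ^ n * (of_real \<tau> ^ n * (resolvent_symbol l y \<tau> * interval_fourier T g \<tau>)))"
    by (rule ext) (simp only: H_def power_mult_distrib mult.assoc)
  have int: "integrable lborel (H n)"
    unfolding eq by (intro integrable_mult_right H)
  have "(\<lambda>\<tau>. of_real \<tau> * H n \<tau>) =
      (\<lambda>\<tau>. (- \<i>) ^ n * (of_real \<tau> ^ Suc n * (resolvent_symbol l y \<tau> * interval_fourier T g \<tau>)))"
    by (simp add: eq mult_ac)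
  then have int1: "integrable lborel (\<lambda>\<tau>. of_real \<tau> * H n \<tau>)"
    by (simp only:) (intro integrable_mult_right H)
  have "(\<lambda>\<tau>. - \<i> * of_real \<tau> * H n \<tau>) = H (Suc n)"
    by (rule ext) (simp only: H_def power_Suc mult.assoc)
  with inv_fourier_has_vector_derivative[OF int int1, of t]
  have "(inv_fourier (H n) has_vector_derivative inv_fourier (H (Suc n)) t) (at t)"
    by (simp only:)
  then show ?thesis
    by (simp only: resolvent_deriv_def H_def[abs_def])
qed

lemma resolvent_deriv_0:
  "resolvent_deriv l y 0 t = inv_fourier (\<lambda>\<tau>. resolvent_symbol l y \<tau> * interval_fourier T g \<tau>) t"
  by (simp add: resolvent_deriv_def)

text \<open>In symbols, e x + e x * r (2 l) = r x. The two summands of the datum are treated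
  separately: \<open>g\<close> is only integrable and known on the interval, while the correction is
  a causal kernel on the whole line.\<close>

lemma right_half_line_solution_resolvent:
  assumes l: "l > 0" and x: "x > 0" and t: "t \<le> T"
  shows "right_half_line_solution (\<lambda>z. g z + resolvent_deriv l (2 * l) 0 z) x t = resolvent_deriv l x 0 t"
proof -
  let ?M = "lebesgue_on {0<..<t}"
  let ?G = "interval_fourier T g"
  have E: "integrable lborel (heat_symbol x)" by (rule integrable_heat_symbol[OF x])
  have R: "integrable lborel (resolvent_symbol l y)" if "y > 0" for y
    by (rule integrable_resolvent_symbol[OF l that])
  define A where "A = resolvent_deriv l (2 * l) 0"
  have A_cont: "continuous_on UNIV A"
    unfolding A_def resolvent_deriv_0[abs_def]
    by (intro continuous_inv_fourier integrable_mult_interval_fourier R) (use l in simp)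
  have A_int: "integrable ?M A"
    by (intro L2_space_integrable continuous_L2_space A_cont)
  have g_int: "integrable ?M g"
    by (rule integrable_lebesgue_on_subinterval[OF t])
  obtain C where C: "\<And>s. norm (inv_fourier (heat_symbol x) s) \<le> C"
    using norm_inv_fourier_le by blast
  have prod: "integrable ?M (\<lambda>z. inv_fourier (heat_symbol x) (t - z) * f z)" if "integrable ?M f" for f
  proof (rule integrable_bounded_mult[OF that _ C])
    show "(\<lambda>z. inv_fourier (heat_symbol x) (t - z)) \<in> borel_measurable ?M"
      by (rule borel_measurable_lebesgue_on_continuous)
        (auto intro!: continuous_on_compose2[OF continuous_inv_fourier[OF E]] continuous_intros)
  qed
  have "right_half_line_solution (\<lambda>z. g z + A z) x t =
      (LINT z|?M. inv_fourier (heat_symbol x) (t - z) * (g z + A z))"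
    using x A_int g_int by (intro right_half_line_solution_eq) auto
  also have "\<dots> = (LINT z|?M. inv_fourier (heat_symbol x) (t - z) * g z) +
      (LINT z|?M. inv_fourier (heat_symbol x) (t - z) * A z)"
    unfolding distrib_left by (intro Bochner_Integration.integral_add prod A_int g_int)
  also have "\<dots> = inv_fourier (\<lambda>\<tau>. heat_symbol x \<tau> * ?G \<tau>) t +
      inv_fourier (\<lambda>\<tau>. resolvent_symbol l (x + 2 * l) \<tau> * ?G \<tau>) t"
    unfolding A_def resolvent_deriv_0
    using l x by (simp only: causal_convolution_interval[OF E inv_fourier_heat_symbol_causal[OF x] t]
        causal_convolution_resolvent)
  also have "\<dots> = inv_fourier (\<lambda>\<tau>. heat_symbol x \<tau> * ?G \<tau> + resolvent_symbol l (x + 2 * l) \<tau> * ?G \<tau>) t"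
    using l x by (intro inv_fourier_add[symmetric] integrable_mult_interval_fourier E R) auto
  \<comment> \<open>The symbols may differ at \<tau> = 0, where the resolvent symbols take the value
    0, so they are compared almost everywhere.\<close>
  also have "\<dots> = inv_fourier (\<lambda>\<tau>. resolvent_symbol l x \<tau> * ?G \<tau>) t"
  proof (rule inv_fourier_cong_AE)
    show "AE \<tau> in lborel. heat_symbol x \<tau> * ?G \<tau> + resolvent_symbol l (x + 2 * l) \<tau> * ?G \<tau> =
        resolvent_symbol l x \<tau> * ?G \<tau>"
      using AE_lborel_singleton[of 0]
      by eventually_elim (use resolvent_symbol_eq[OF l, of _ x] in \<open>simp add: distrib_right add.commute\<close>)
  qed measurable
  finally show ?thesis
    by (simp only: A_def resolvent_deriv_0)
qed

text \<open>In symbols, e (l - x) * r l = r (2 l - x).\<close>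

lemma left_half_line_solution_resolvent:
  assumes l: "l > 0" and x: "x < l"
  shows "left_half_line_solution l (\<lambda>z. - resolvent_deriv l l 0 z) x t = - resolvent_deriv l (2 * l - x) 0 t"
proof -
  have "continuous_on UNIV (\<lambda>z. - resolvent_deriv l l 0 z)"
    unfolding resolvent_deriv_0
    by (intro continuous_on_minus continuous_inv_fourier integrable_mult_interval_fourier
        integrable_resolvent_symbol l)
  then have "left_half_line_solution l (\<lambda>z. - resolvent_deriv l l 0 z) x t =
      (LINT z|lebesgue_on {0<..<t}. inv_fourier (heat_symbol (l - x)) (t - z) * - resolvent_deriv l l 0 z)"
    by (intro left_half_line_solution_eq x L2_space_integrable continuous_L2_space)
  also have "\<dots> = - resolvent_deriv l ((l - x) + l) 0 t"
    using l x unfolding resolvent_deriv_0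
    by (subst causal_convolution_resolvent[symmetric]) auto
  finally show ?thesis by (simp add: algebra_simps)
qed

lemma interval_solution_resolvent:
  assumes x: "x \<in> {0<..<l}" and t: "t \<le> T"
  shows "interval_solution l g x t = resolvent_deriv l x 0 t - resolvent_deriv l (2 * l - x) 0 t"
proof -
  let ?E = "\<lambda>\<tau>. resolvent_symbol l x \<tau> - resolvent_symbol l (2 * l - x) \<tau>"
  have R: "integrable lborel (resolvent_symbol l x)" "integrable lborel (resolvent_symbol l (2 * l - x))"
    using x by (auto intro: integrable_resolvent_symbol)
  have E: "integrable lborel ?E"
    by (intro Bochner_Integration.integrable_diff R)
  have causal: "inv_fourier ?E s = 0" if "s \<le> 0" for s
    using that x by (simp add: inv_fourier_diff[OF R] inv_fourier_resolvent_symbol_causal)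
  have "interval_solution l g x t = inv_fourier (\<lambda>\<tau>. ?E \<tau> * interval_fourier T g \<tau>) t"
    unfolding interval_solution_eq[OF x integrable_lebesgue_on_subinterval[OF t]]
    by (rule causal_convolution_interval[OF E causal t])
  also have "\<dots> = resolvent_deriv l x 0 t - resolvent_deriv l (2 * l - x) 0 t"
    unfolding left_diff_distrib resolvent_deriv_0
    by (intro inv_fourier_diff integrable_mult_interval_fourier R)
  finally show ?thesis .
qed

end

theorem theorem1:
  fixes m l T :: real and g :: "real \<Rightarrow> complex"
  assumes "0 \<le> m" and "0 < l"
    and "0 < T" and "T \<le> sqrt pi * exp (3 / 2) / (2 * 3 powr (5 / 4)) * l\<^sup>2"
    and "g \<in> sobolev m T"
    and "\<And>n::nat. real n < m - 1 / 2 \<Longrightarrow> zero_trace T n g"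
  shows "\<exists>a \<in> sobolev m T. \<exists>b \<in> sobolev m T.
    (AE t in lebesgue_on {0<..<T}. a t = g t - left_half_line_solution l b 0 t) \<and>
    (AE t in lebesgue_on {0<..<T}. b t = - right_half_line_solution a l t) \<and>
    (\<forall>x \<in> {0<..<l}. \<forall>t \<in> {0<..<T}.
       interval_solution l g x t =
         right_half_line_solution a x t + left_half_line_solution l b x t)"
proof -
  have g: "integrable (lebesgue_on {0<..<T}) g"
    using assms(5) by (intro L2_space_integrable) (simp add: sobolev_def)
  define D where "D = resolvent_deriv T g l"
  have D: "(D y n has_vector_derivative D y (Suc n) t) (at t)" if "y > 0" for y n t
    unfolding D_def by (rule resolvent_deriv_has_vector_derivative[OF g assms(2) that])
  define a where "a t = g t + D (2 * l) 0 t" for t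
  define b where "b t = - D l 0 t" for t
  \<comment> \<open>The admissible x include the far end points: x = l here gives
    \<open>D l 0\<close> and x = 0 in \<open>left\<close> gives \<open>- D (2 * l) 0\<close>,
    exactly the terms that enter \<open>b\<close> and \<open>a\<close>.\<close>
  have right: "right_half_line_solution a x t = D x 0 t" if "x > 0" "t < T" for x t
    using right_half_line_solution_resolvent[OF g assms(2), of x t] that by (simp add: a_def[abs_def] D_def)
  have left: "left_half_line_solution l b x t = - D (2 * l - x) 0 t" if "x < l" for x t
    using left_half_line_solution_resolvent[OF g assms(2) that] by (simp add: b_def[abs_def] D_def)
  show ?thesis
  proof (rule bexI[of _ a], rule bexI[of _ b], intro conjI ballI)
    show "a \<in> sobolev m T"
      unfolding a_def using assms(2) by (intro sobolev_add_smooth assms(1,3,5) D) simp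
    show "b \<in> sobolev m T"
      unfolding b_def by (intro uminus_smooth_in_sobolev assms(1,3) D assms(2))
    show "AE t in lebesgue_on {0<..<T}. a t = g t - left_half_line_solution l b 0 t"
      using left[of 0] assms(2) by (simp add: a_def)
    show "AE t in lebesgue_on {0<..<T}. b t = - right_half_line_solution a l t"
      using right[of l] assms(2) by (intro AE_I2) (auto simp: b_def space_restrict_space)
    fix x t assume "x \<in> {0<..<l}" "t \<in> {0<..<T}"
    then show "interval_solution l g x t =
        right_half_line_solution a x t + left_half_line_solution l b x t"
      using right[of x t] left[of x t] interval_solution_resolvent[OF g, of x l t] by (simp add: D_def)
  qed
qed

end
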